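(* For every $\epsilon>0$ there is a constant $C(\epsilon)$ such that the following holds. Let $N=2l+1\ge 3$ be odd, let $V_N=\mathbb Z/N\mathbb Z$ be the vertex set of the circle graph on $N$ vertices, and let $P$ be the Markov kernel on $V_N$ given by $$P(x,y)=\begin{cases}1/2,&\text{if }x=y,\\ 1/4,&\text{if }|x-y|=1\text{ and }x\notin\{0,1\},\\ \frac{1+\epsilon}{2(2+\epsilon)},&\text{if }(x,y)\in\{(0,1),(1,0)\},\\ \frac{1}{2(2+\epsilon)},&\text{if }(x,y)\in\{(0,-1),(1,2)\},\\ 0,&\text{otherwise.}\end{cases}$$ Let $g$ be any permutation of $V_N$, let $P_i(x,y)=P(g^{i-1}x,g^{i-1}y)$ for $i=1,2,\dots$, let $\widetilde P(x,y)=P(x,g^{-1}y)$, and let $\widetilde\pi$ be the invariant probability measure of $\widetilde P$. Then $$\max_{x\in V_N}\{\widetilde\pi(x)\}\le(1+\epsilon)\min_{x\in V_N}\{\widetilde\pi(x)\}.$$ Furthermore, for all $\eta>0$ the relative-sup merging time of $(P_i)_1^\infty$ satisfies $$T_\infty(\eta)\le C(\epsilon)\,N^2\,(1+\log_+(1/\eta)).$$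
   Context: Elements of $\mathbb Z/N\mathbb Z$ are added modulo $N$; $|x-y|=1$ means $x-y\equiv\pm1\pmod N$. For the sequence $(P_i)_1^\infty$ of Markov kernels, $P_{0,n}=P_1P_2\cdots P_n$ (matrix product), and for $\eta>0$ the $\eta$ relative-sup merging time is $$T_\infty(\eta)=\min\left\{n:\max_{x,y,z\in V_N}\left|\frac{P_{0,n}(x,z)}{P_{0,n}(y,z)}-1\right|<\eta\right\},$$ where the maximum is taken to be $+\infty$ if some $P_{0,n}(y,z)=0$. Also $\log_+t=\max\{\log t,0\}$. The constant $C(\epsilon)$ does not depend on $N$, $g$ or $\eta$. *)

theory Defs
  imports
    Complex_Main
    "HOL-Combinatorics.Permutations"
    "HOL-Library.Extended_Real"
begin

text \<open>
  The group of integers modulo \<open>N\<close> is represented by the residues \<open>0, \<dots>, N - 1\<close>, so that the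
  vertex \<open>-1\<close> is \<open>(-1) mod N = N - 1\<close>. An explicit carrier is used because the constant of the
  theorem is chosen before \<open>N\<close>. Kernels and measures are functions on \<open>int\<close> of which only the
  values on the carrier matter.
\<close>

definition vertices :: "int \<Rightarrow> int set" where
  "vertices N = {0..<N}"

definition circle_adj :: "int \<Rightarrow> int \<Rightarrow> int \<Rightarrow> bool" where
  "circle_adj N x y \<longleftrightarrow> (x - y) mod N = 1 mod N \<or> (x - y) mod N = (-1) mod N"

definition circle_kernel :: "real \<Rightarrow> int \<Rightarrow> int \<Rightarrow> int \<Rightarrow> real" where
  "circle_kernel \<epsilon> N x y =
     (if x = y then 1 / 2
      else if circle_adj N x y \<and> x \<notin> {0, 1} then 1 / 4
      else if (x, y) \<in> {(0, 1), (1, 0)} then (1 + \<epsilon>) / (2 * (2 + \<epsilon>))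
      else if (x, y) \<in> {(0, (-1) mod N), (1, 2)} then 1 / (2 * (2 + \<epsilon>))
      else 0)"

definition kernel_comp ::
  "'a set \<Rightarrow> ('a \<Rightarrow> 'a \<Rightarrow> real) \<Rightarrow> ('a \<Rightarrow> 'a \<Rightarrow> real) \<Rightarrow> 'a \<Rightarrow> 'a \<Rightarrow> real" where
  "kernel_comp V K L x z = (\<Sum>y\<in>V. K x y * L y z)"

text \<open>
  \<open>iter_kernel V K n\<close> is the product \<open>K 1 \<cdots> K n\<close>; the value \<open>K 0\<close> is never used.
\<close>

fun iter_kernel :: "'a set \<Rightarrow> (nat \<Rightarrow> 'a \<Rightarrow> 'a \<Rightarrow> real) \<Rightarrow> nat \<Rightarrow> 'a \<Rightarrow> 'a \<Rightarrow> real" where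
  "iter_kernel V K 0 = (\<lambda>x y. if x = y then 1 else 0)"
| "iter_kernel V K (Suc n) = kernel_comp V (iter_kernel V K n) (K (Suc n))"

definition rel_sup_dev :: "'a set \<Rightarrow> ('a \<Rightarrow> 'a \<Rightarrow> real) \<Rightarrow> ereal" where
  "rel_sup_dev V K =
     (if \<exists>y\<in>V. \<exists>z\<in>V. K y z = 0 then \<infinity>
      else ereal (Max {\<bar>K x z / K y z - 1\<bar> | x y z. x \<in> V \<and> y \<in> V \<and> z \<in> V}))"

text \<open>
  The infimum of the empty set in \<open>enat\<close> is \<open>\<infinity>\<close>, so a finite upper bound on the merging time
  includes the assertion that merging occurs. A finite infimum is attained. Including \<open>n = 0\<close>
  is harmless: if the carrier has at least two elements, the identity kernel has a zero entry.
\<close>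

definition rel_sup_merging_time ::
  "'a set \<Rightarrow> (nat \<Rightarrow> 'a \<Rightarrow> 'a \<Rightarrow> real) \<Rightarrow> real \<Rightarrow> enat" where
  "rel_sup_merging_time V K \<eta> =
     Inf (enat ` {n. rel_sup_dev V (iter_kernel V K n) < ereal \<eta>})"

text \<open>
  Vanishing outside the carrier makes uniqueness as a function the same as uniqueness as a
  measure on the carrier.
\<close>

definition invariant_prob :: "'a set \<Rightarrow> ('a \<Rightarrow> 'a \<Rightarrow> real) \<Rightarrow> ('a \<Rightarrow> real) \<Rightarrow> bool" where
  "invariant_prob V K \<pi> \<longleftrightarrow>
     (\<forall>x\<in>V. 0 \<le> \<pi> x) \<and> (\<forall>x. x \<notin> V \<longrightarrow> \<pi> x = 0) \<and> (\<Sum>x\<in>V. \<pi> x) = 1 \<and>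
     (\<forall>y\<in>V. (\<Sum>x\<in>V. \<pi> x * K x y) = \<pi> y)"

definition shifted_kernels ::
  "('a \<Rightarrow> 'a \<Rightarrow> real) \<Rightarrow> ('a \<Rightarrow> 'a) \<Rightarrow> nat \<Rightarrow> 'a \<Rightarrow> 'a \<Rightarrow> real" where
  "shifted_kernels P g i x y = P ((g ^^ (i - 1)) x) ((g ^^ (i - 1)) y)"

definition twisted_kernel :: "('a \<Rightarrow> 'a \<Rightarrow> real) \<Rightarrow> ('a \<Rightarrow> 'a) \<Rightarrow> 'a \<Rightarrow> 'a \<Rightarrow> real" where
  "twisted_kernel P g x y = P x (inv g y)"

definition log_plus :: "real \<Rightarrow> real" where
  "log_plus t = max (ln t) 0"

end

theory Submission
  imports Defs "HOL-Analysis.Convex"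
begin

text \<open>
  The product \<open>P 1 \<cdots> P n\<close> is the \<open>n\<close>-th power of the twisted kernel up to a relabelling of the
  second argument by \<open>g ^^ n\<close>, so everything reduces to one kernel with invariant measure \<open>\<pi>\<close>.

  Invariance says that \<open>\<pi>\<close> and its push-forward under the circle kernel have the same level sets up
  to \<open>g\<close>, so the minimal level set keeps its cardinality; by isoperimetry on the circle the push-forward
  must attain its minimum at \<open>-1\<close> or \<open>2\<close>, and likewise its maximum at \<open>0\<close> or \<open>1\<close>. The balance
  equations there give the ratio \<open>1 + \<epsilon>\<close>.

  For merging, one step decreases the \<open>\<pi>\<close>-variance of a mean-zero function by a multiple of the
  Dirichlet form of the circle, whatever \<open>g\<close> is. A Nash inequality for mean-zero functions brings
  the variance of \<open>K\<^sup>n(\<cdot>, z) - \<pi> z\<close> down to order \<open>1 / N\<close> after \<open>N\<^sup>2\<close> steps, and the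
  Poincare inequality makes it decay geometrically on the scale \<open>N\<^sup>2\<close> from then on. In each window
  of \<open>N\<^sup>2\<close> steps the Dirichlet form is small at least once, which bounds the supremum at that time,
  and suprema do not increase under a Markov kernel.
\<close>

section \<open>Finite Markov kernels\<close>

definition stochastic :: "'a set \<Rightarrow> ('a \<Rightarrow> 'a \<Rightarrow> real) \<Rightarrow> bool" where
  "stochastic V K \<longleftrightarrow> (\<forall>x\<in>V. \<forall>y\<in>V. 0 \<le> K x y) \<and> (\<forall>x\<in>V. (\<Sum>y\<in>V. K x y) = 1)"

abbreviation kernel_power :: "'a set \<Rightarrow> ('a \<Rightarrow> 'a \<Rightarrow> real) \<Rightarrow> nat \<Rightarrow> 'a \<Rightarrow> 'a \<Rightarrow> real" where
  "kernel_power V K n \<equiv> iter_kernel V (\<lambda>_. K) n"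

lemma stochastic_nonneg: "stochastic V K \<Longrightarrow> x \<in> V \<Longrightarrow> y \<in> V \<Longrightarrow> 0 \<le> K x y"
  and stochastic_sum: "stochastic V K \<Longrightarrow> x \<in> V \<Longrightarrow> (\<Sum>y\<in>V. K x y) = 1"
  by (auto simp: stochastic_def)

lemma stochastic_kernel_comp:
  assumes "stochastic V K" "stochastic V L"
  shows "stochastic V (kernel_comp V K L)"
  unfolding stochastic_def kernel_comp_def
proof (intro conjI ballI)
  fix x y assume "x \<in> V" "y \<in> V"
  then show "0 \<le> (\<Sum>u\<in>V. K x u * L u y)"
    using assms by (intro sum_nonneg) (auto simp: stochastic_def)
next
  fix x assume x: "x \<in> V"
  have "(\<Sum>y\<in>V. \<Sum>u\<in>V. K x u * L u y) = (\<Sum>u\<in>V. \<Sum>y\<in>V. K x u * L u y)"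
    by (rule sum.swap)
  also have "\<dots> = (\<Sum>u\<in>V. K x u)"
    by (rule sum.cong) (simp_all add: stochastic_sum[OF assms(2)] flip: sum_distrib_left)
  finally show "(\<Sum>y\<in>V. \<Sum>u\<in>V. K x u * L u y) = 1"
    using stochastic_sum[OF assms(1) x] by simp
qed

lemma stochastic_kernel_power:
  assumes "finite V" "stochastic V K"
  shows "stochastic V (kernel_power V K n)"
proof (induction n)
  case 0
  then show ?case using assms(1) by (auto simp: stochastic_def)
next
  case (Suc n)
  then show ?case using stochastic_kernel_comp[OF Suc assms(2)] by simp
qed

lemma kernel_comp_assoc:
  "kernel_comp V (kernel_comp V J K) L x z = kernel_comp V J (kernel_comp V K L) x z"
proof -
  have "(\<Sum>y\<in>V. \<Sum>u\<in>V. J x u * K u y * L y z) = (\<Sum>u\<in>V. \<Sum>y\<in>V. J x u * K u y * L y z)"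
    by (rule sum.swap)
  then show ?thesis
    by (simp add: kernel_comp_def sum_distrib_left sum_distrib_right mult.assoc)
qed

lemma kernel_power_add:
  assumes "finite V" "z \<in> V"
  shows "kernel_power V K (m + n) x z
    = (\<Sum>y\<in>V. kernel_power V K m x y * kernel_power V K n y z)"
  using assms(2)
proof (induction n arbitrary: z)
  case 0
  then show ?case using assms(1) by (simp add: if_distrib cong: if_cong)
next
  case (Suc n)
  have "kernel_power V K (m + Suc n) x z = (\<Sum>y\<in>V. kernel_power V K (m + n) x y * K y z)"
    by (simp add: kernel_comp_def)
  also have "\<dots> = (\<Sum>y\<in>V. kernel_comp V (kernel_power V K m) (kernel_power V K n) x y * K y z)"
    by (rule sum.cong) (simp_all add: Suc kernel_comp_def)
  also have "\<dots> = kernel_comp V (kernel_comp V (kernel_power V K m) (kernel_power V K n)) K x z"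
    by (simp add: kernel_comp_def)
  also have "\<dots> = kernel_comp V (kernel_power V K m) (kernel_power V K (Suc n)) x z"
    by (simp add: kernel_comp_assoc)
  finally show ?case by (simp add: kernel_comp_def)
qed

lemma kernel_power_Suc_left:
  assumes "finite V" "x \<in> V" "z \<in> V"
  shows "kernel_power V K (Suc n) x z = (\<Sum>y\<in>V. K x y * kernel_power V K n y z)"
proof -
  have "(\<Sum>y\<in>V. (if x = y then 1 else 0) * K y u) = K x u" for u
    using assms(1,2) by (simp add: if_distrib if_distribR cong: if_cong)
  then have "kernel_power V K 1 x u = K x u" for u
    by (simp add: kernel_comp_def)
  then show ?thesis
    using kernel_power_add[OF assms(1,3), of K 1 n x] by simp
qed

lemma invariant_kernel_power:
  assumes "finite V" "\<And>y. y \<in> V \<Longrightarrow> (\<Sum>x\<in>V. \<pi> x * K x y) = \<pi> y" "y \<in> V"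
  shows "(\<Sum>x\<in>V. \<pi> x * kernel_power V K n x y) = \<pi> y"
  using assms(3)
proof (induction n arbitrary: y)
  case 0
  then show ?case using assms(1) by (simp add: if_distrib cong: if_cong)
next
  case (Suc n)
  have "(\<Sum>x\<in>V. \<pi> x * kernel_power V K (Suc n) x y)
      = (\<Sum>x\<in>V. \<Sum>u\<in>V. \<pi> x * kernel_power V K n x u * K u y)"
    by (simp add: kernel_comp_def sum_distrib_left mult.assoc)
  also have "\<dots> = (\<Sum>u\<in>V. \<Sum>x\<in>V. \<pi> x * kernel_power V K n x u * K u y)"
    by (rule sum.swap)
  also have "\<dots> = (\<Sum>u\<in>V. \<pi> u * K u y)"
    by (rule sum.cong) (simp_all add: Suc.IH flip: sum_distrib_right)
  finally show ?case using assms(2)[OF Suc.prems] by simp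
qed

section \<open>Contraction of oscillation and the invariant measure\<close>

lemma stochastic_average_le:
  assumes "stochastic V K" "x \<in> V" "\<And>u. u \<in> V \<Longrightarrow> f u \<le> M"
  shows "(\<Sum>u\<in>V. K x u * f u) \<le> M"
proof -
  have "(\<Sum>u\<in>V. K x u * f u) \<le> (\<Sum>u\<in>V. K x u * M)"
    using assms by (intro sum_mono mult_left_mono) (auto simp: stochastic_def)
  also have "\<dots> = M"
    using stochastic_sum[OF assms(1,2)] by (simp flip: sum_distrib_right)
  finally show ?thesis .
qed

lemma stochastic_average_ge:
  assumes "stochastic V K" "x \<in> V" "\<And>u. u \<in> V \<Longrightarrow> m \<le> f u"
  shows "m \<le> (\<Sum>u\<in>V. K x u * f u)"
  using stochastic_average_le[OF assms(1,2), of "\<lambda>u. - f u" "- m"] assms(3)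
  by (simp add: sum_negf)

text \<open>Every row puts mass at least \<open>\<delta>\<close> on the point \<open>w\<close> where
  \<open>f\<close> is minimal, so the average falls short of \<open>M\<close> by at least
  \<open>\<delta> * (M - m)\<close>. This is the one-sided form of Doeblin's contraction.\<close>

lemma positive_kernel_oscillation:
  assumes fin: "finite V" and K: "stochastic V K" and pos: "\<And>x y. x \<in> V \<Longrightarrow> y \<in> V \<Longrightarrow> \<delta> \<le> K x y"
    and x: "x \<in> V" and bounds: "\<And>u. u \<in> V \<Longrightarrow> m \<le> f u \<and> f u \<le> M" and w: "w \<in> V" "f w = m"
  shows "(\<Sum>u\<in>V. K x u * f u) \<le> M - \<delta> * (M - m)"
proof -
  have "\<delta> * (M - m) \<le> K x w * (M - f w)"
    using pos[OF x w(1)] bounds[OF w(1)] w(2) by (auto intro: mult_right_mono)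
  also have "\<dots> \<le> (\<Sum>u\<in>V. K x u * (M - f u))"
    using fin w(1) bounds stochastic_nonneg[OF K x] by (intro member_le_sum) auto
  also have "\<dots> = M - (\<Sum>u\<in>V. K x u * f u)"
    using stochastic_sum[OF K x] by (simp add: right_diff_distrib sum_subtractf flip: sum_distrib_right)
  finally show ?thesis by simp
qed

text \<open>In a fixed column the maximum over starting points decreases, the minimum increases, and
  their gap contracts by \<open>1 - \<delta>\<close> every \<open>m\<close> steps. The common limit
  is positive because the minimum at time \<open>m\<close> already is.\<close>

lemma kernel_power_limit:
  assumes fin: "finite V" and ne: "V \<noteq> {}" and K: "stochastic V K" and "0 < m"
    and pos: "\<And>x y. x \<in> V \<Longrightarrow> y \<in> V \<Longrightarrow> 0 < kernel_power V K m x y"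
    and z: "z \<in> V"
  shows "\<exists>l>0. \<forall>x\<in>V. (\<lambda>n. kernel_power V K n x z) \<longlonglongrightarrow> l"
proof -
  define f where "f n x = kernel_power V K n x z" for n x
  define U where "U n = Max (f n ` V)" for n
  define L where "L n = Min (f n ` V)" for n
  define \<delta> where "\<delta> = Min ((\<lambda>(x, y). kernel_power V K m x y) ` (V \<times> V))"
  have "\<delta> \<in> (\<lambda>(x, y). kernel_power V K m x y) ` (V \<times> V)"
    unfolding \<delta>_def using fin ne by (intro Min_in) auto
  then have \<delta>0: "0 < \<delta>" using pos by auto
  have \<delta>: "\<delta> \<le> kernel_power V K m x y" if "x \<in> V" "y \<in> V" for x y
    unfolding \<delta>_def using fin that by (intro Min_le) auto
  have fU: "f n x \<le> U n" and Lf: "L n \<le> f n x" if "x \<in> V" for n x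
    using fin that by (auto simp: U_def L_def)
  obtain x0 where x0: "x0 \<in> V" using ne by auto
  have LU: "L n \<le> U n" for n using fU[OF x0] Lf[OF x0] by (meson order_trans)
  have rec: "f (k + n) x = (\<Sum>y\<in>V. kernel_power V K k x y * f n y)" for k n x
    using kernel_power_add[OF fin z] by (simp add: f_def)
  note Kn = stochastic_kernel_power[OF fin K]
  have Uk: "U (k + n) \<le> U n" and Lk: "L n \<le> L (k + n)" for k n
    unfolding U_def[of "k + n"] L_def[of "k + n"] using fin ne fU Lf
    by (auto simp: rec intro!: stochastic_average_le[OF Kn] stochastic_average_ge[OF Kn])
  have Udec: "decseq U" and Linc: "incseq L"
    using Uk[of 1] Lk[of _ 1] by (auto intro: decseq_SucI incseq_SucI)
  have osc: "U (m + n) - L (m + n) \<le> (1 - \<delta>) * (U n - L n)" for n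
  proof -
    have "L n \<in> f n ` V" unfolding L_def using fin ne by (intro Min_in) auto
    then obtain w where w: "w \<in> V" "f n w = L n" by auto
    have "f (m + n) x \<le> U n - \<delta> * (U n - L n)" if "x \<in> V" for x
      unfolding rec using fU Lf w \<delta> that
      by (intro positive_kernel_oscillation[OF fin Kn, where w = w and f = "f n"]) auto
    then have "U (m + n) \<le> U n - \<delta> * (U n - L n)"
      unfolding U_def[of "m + n"] using fin ne by auto
    with Lk[of n m] show ?thesis by (simp add: algebra_simps)
  qed
  have \<delta>1: "\<delta> \<le> 1"
    using \<delta>[OF x0 x0] stochastic_sum[OF Kn[of m] x0]
      member_le_sum[of x0 V "kernel_power V K m x0"] stochastic_nonneg[OF Kn[of m] x0] fin x0 by auto
  have "U (m * k) - L (m * k) \<le> (1 - \<delta>) ^ k * (U 0 - L 0)" for k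
  proof (induction k)
    case (Suc k)
    have "U (m * Suc k) - L (m * Suc k) \<le> (1 - \<delta>) * (U (m * k) - L (m * k))"
      using osc[of "m * k"] by simp
    also have "\<dots> \<le> (1 - \<delta>) * ((1 - \<delta>) ^ k * (U 0 - L 0))"
      using Suc \<delta>1 by (intro mult_left_mono) auto
    finally show ?case by simp
  qed simp
  moreover have "(\<lambda>k. (1 - \<delta>) ^ k * (U 0 - L 0)) \<longlonglongrightarrow> 0 * (U 0 - L 0)"
    using \<delta>0 \<delta>1 by (intro tendsto_mult_right LIMSEQ_power_zero) auto
  ultimately have sub: "(\<lambda>k. U (m * k) - L (m * k)) \<longlonglongrightarrow> 0"
    using LU by (rule_tac tendsto_sandwich[where f = "\<lambda>_. 0"
      and h = "\<lambda>k. (1 - \<delta>) ^ k * (U 0 - L 0)"]) simp_all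
  have "L n \<le> U 0" "L 0 \<le> U n" for n
    using LU[of n] Uk[of n 0] Lk[of 0 n] by auto
  then obtain u l where u: "U \<longlonglongrightarrow> u" and l: "L \<longlonglongrightarrow> l" "\<And>n. L n \<le> l"
    using incseq_convergent[OF Linc, of "U 0"] decseq_convergent[OF Udec, of "L 0"] by metis
  \<comment> \<open>The gap is known to vanish only along multiples of \<open>m\<close>; since both
    monotone sequences converge, this identifies their limits.\<close>
  have "strict_mono (\<lambda>k. m * k)" using \<open>0 < m\<close> by (simp add: strict_mono_def)
  from LIMSEQ_subseq_LIMSEQ[OF tendsto_diff[OF u l(1)] this]
  have "(\<lambda>k. U (m * k) - L (m * k)) \<longlonglongrightarrow> u - l" by (simp add: o_def)
  then have "u = l" using LIMSEQ_unique[OF sub] by force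
  have "(\<lambda>n. f n x) \<longlonglongrightarrow> l" if "x \<in> V" for x
    using fU[OF that] Lf[OF that] l(1) u unfolding \<open>u = l\<close>
    by (rule_tac tendsto_sandwich[of L "\<lambda>n. f n x" sequentially U]) simp_all
  moreover have "0 < l"
  proof -
    have "0 < L m" unfolding L_def f_def using fin ne pos z by auto
    then show ?thesis using l(2)[of m] by linarith
  qed
  ultimately show ?thesis unfolding f_def by blast
qed

text \<open>The limit of a column does not depend on the start. A shift of time by one shows that
  the limiting row is invariant, and averaging the columns against any invariant measure returns
  that same row.\<close>

lemma invariant_prob_exists_unique:
  assumes fin: "finite V" and ne: "V \<noteq> {}" and K: "stochastic V K" and m: "0 < m"
    and pos: "\<And>x y. x \<in> V \<Longrightarrow> y \<in> V \<Longrightarrow> 0 < kernel_power V K m x y"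
  shows "\<exists>!\<pi>. invariant_prob V K \<pi>"
proof -
  obtain l where l: "\<And>z. z \<in> V \<Longrightarrow> 0 < l z"
      "\<And>x z. x \<in> V \<Longrightarrow> z \<in> V \<Longrightarrow> (\<lambda>n. kernel_power V K n x z) \<longlonglongrightarrow> l z"
    using kernel_power_limit[OF fin ne K m pos] by metis
  obtain x0 where x0: "x0 \<in> V" using ne by auto
  note Kn = stochastic_kernel_power[OF fin K]
  have "(\<lambda>n. \<Sum>z\<in>V. kernel_power V K n x0 z) \<longlonglongrightarrow> (\<Sum>z\<in>V. l z)"
    using l(2)[OF x0] by (intro tendsto_sum) auto
  then have sum_l: "(\<Sum>z\<in>V. l z) = 1"
    using stochastic_sum[OF Kn x0] by (simp add: LIMSEQ_const_iff)
  have inv_l: "(\<Sum>x\<in>V. l x * K x y) = l y" if "y \<in> V" for y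
  proof (rule LIMSEQ_unique)
    show "(\<lambda>n. kernel_power V K (Suc n) x0 y) \<longlonglongrightarrow> (\<Sum>x\<in>V. l x * K x y)"
      using l(2)[OF x0] by (auto simp: kernel_comp_def intro!: tendsto_intros)
    show "(\<lambda>n. kernel_power V K (Suc n) x0 y) \<longlonglongrightarrow> l y"
      using l(2)[OF x0 that] by (rule LIMSEQ_Suc)
  qed
  show ?thesis
  proof (rule ex1I)
    show "invariant_prob V K (\<lambda>z. if z \<in> V then l z else 0)"
      using l(1) sum_l inv_l by (auto simp: invariant_prob_def less_imp_le)
  next
    fix \<pi> assume \<pi>: "invariant_prob V K \<pi>"
    have "\<pi> z = l z" if "z \<in> V" for z
    proof -
      have "(\<lambda>n. \<Sum>x\<in>V. \<pi> x * kernel_power V K n x z) \<longlonglongrightarrow> (\<Sum>x\<in>V. \<pi> x * l z)"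
        using l(2) that by (auto intro!: tendsto_intros)
      moreover have "(\<Sum>x\<in>V. \<pi> x * kernel_power V K n x z) = \<pi> z" for n
        using \<pi> that by (intro invariant_kernel_power[OF fin]) (auto simp: invariant_prob_def)
      ultimately show ?thesis
        using \<pi> by (simp add: LIMSEQ_const_iff invariant_prob_def flip: sum_distrib_right)
    qed
    then show "\<pi> = (\<lambda>z. if z \<in> V then l z else 0)"
      using \<pi> by (auto simp: invariant_prob_def)
  qed
qed

text \<open>Some point carries mass, and \<open>m\<close> steps spread it to every point.\<close>

lemma invariant_prob_pos:
  assumes "finite V" "stochastic V K" "invariant_prob V K \<pi>"
    and pos: "\<And>x y. x \<in> V \<Longrightarrow> y \<in> V \<Longrightarrow> 0 < kernel_power V K m x y" and "y \<in> V"
  shows "0 < \<pi> y"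
proof -
  obtain x where x: "x \<in> V" "\<pi> x > 0"
    using assms(3) unfolding invariant_prob_def
    by (metis less_eq_real_def sum.neutral zero_neq_one)
  have "0 < \<pi> x * kernel_power V K m x y" using x pos[OF x(1) \<open>y \<in> V\<close>] by simp
  also have "\<dots> \<le> (\<Sum>x\<in>V. \<pi> x * kernel_power V K m x y)"
    using assms x by (intro member_le_sum) (auto simp: invariant_prob_def less_imp_le)
  also have "\<dots> = \<pi> y"
    using assms by (intro invariant_kernel_power) (auto simp: invariant_prob_def)
  finally show ?thesis .
qed

section \<open>Nash and Poincare inequalities on the circle\<close>

text \<open>The wrap-around is a case distinction on representatives, which reduces questions of
  adjacency to linear arithmetic without \<open>mod\<close>.\<close>

definition csuc :: "int \<Rightarrow> int \<Rightarrow> int" where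
  "csuc N x = (if x = N - 1 then 0 else x + 1)"

definition cpred :: "int \<Rightarrow> int \<Rightarrow> int" where
  "cpred N x = (if x = 0 then N - 1 else x - 1)"

lemma finite_vertices [simp]: "finite (vertices N)"
  by (simp add: vertices_def)

lemma csuc_in [simp]: "x \<in> vertices N \<Longrightarrow> csuc N x \<in> vertices N"
  and cpred_in [simp]: "x \<in> vertices N \<Longrightarrow> cpred N x \<in> vertices N"
  and csuc_cpred [simp]: "x \<in> vertices N \<Longrightarrow> csuc N (cpred N x) = x"
  and cpred_csuc [simp]: "x \<in> vertices N \<Longrightarrow> cpred N (csuc N x) = x"
  by (auto simp: vertices_def csuc_def cpred_def)

lemma bij_betw_csuc: "bij_betw (csuc N) (vertices N) (vertices N)"
  by (rule bij_betw_byWitness[where f' = "cpred N"]) auto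

lemma sum_csuc: "(\<Sum>x\<in>vertices N. f (csuc N x)) = (\<Sum>x\<in>vertices N. f x)"
  by (rule sum.reindex_bij_betw[OF bij_betw_csuc])

text \<open>Stepping down from any element reaches 0; the next step wraps around to
  \<open>N - 1\<close>, and from there every vertex is reached.\<close>

lemma cpred_closed_eq_vertices:
  assumes S: "S \<subseteq> vertices N" and "S \<noteq> {}" and closed: "\<And>x. x \<in> S \<Longrightarrow> cpred N x \<in> S"
  shows "S = vertices N"
proof -
  have down: "x - int k \<in> S" if "x \<in> S" "int k \<le> x" for x k
    using that
  proof (induction k)
    case (Suc k)
    then have "x - int k \<in> S" "x - int k \<noteq> 0" by auto
    with closed[of "x - int k"] show ?case by (simp add: cpred_def algebra_simps)
  qed simp
  obtain x where x: "x \<in> S" using \<open>S \<noteq> {}\<close> by auto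
  then have "0 \<in> S" using down[of x "nat x"] S by (auto simp: vertices_def)
  then have top: "N - 1 \<in> S" using closed[of 0] by (simp add: cpred_def)
  have "y \<in> S" if "y \<in> vertices N" for y
    using down[OF top, of "nat (N - 1 - y)"] that by (auto simp: vertices_def)
  then show ?thesis using S by auto
qed

text \<open>Otherwise \<open>S \<subseteq> T\<close>, so \<open>S = T\<close> by cardinality, and
  \<open>S\<close> would be closed under \<open>cpred\<close>. This is the isoperimetric input, with
  neighbours taken on one side only.\<close>

lemma cpred_expansion:
  assumes "S \<subseteq> vertices N" "T \<subseteq> vertices N" "card T \<le> card S" "S \<noteq> {}" "S \<noteq> vertices N"
  shows "\<exists>x\<in>S. x \<notin> T \<or> cpred N x \<notin> T"
proof (rule ccontr)
  assume "\<not> ?thesis"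
  then have *: "x \<in> T" "cpred N x \<in> T" if "x \<in> S" for x using that by auto
  have "finite T" using assms(2) finite_vertices by (rule finite_subset)
  then have "S = T" using *(1) assms(3) by (intro card_seteq) auto
  then show False using cpred_closed_eq_vertices[OF assms(1,4)] *(2) assms(5) by auto
qed

section \<open>Functional inequalities for the circle\<close>

lemma circle_variation_bound:
  fixes f :: "int \<Rightarrow> real"
  assumes "x \<in> vertices N" "y \<in> vertices N"
  shows "\<bar>f x - f y\<bar> \<le> (\<Sum>v\<in>vertices N. \<bar>f (csuc N v) - f v\<bar>)"
proof -
  \<comment> \<open>The arc from the smaller to the larger representative avoids the wrap-around
    edge, so the increments telescope over \<open>{x..<y}\<close>.\<close>
  have *: "\<bar>f y - f x\<bar> \<le> (\<Sum>v\<in>vertices N. \<bar>f (csuc N v) - f v\<bar>)"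
    if "x \<le> y" "0 \<le> x" "y < N" for x y
  proof -
    have "y < N \<Longrightarrow> \<bar>f y - f x\<bar> \<le> (\<Sum>v\<in>{x..<y}. \<bar>f (csuc N v) - f v\<bar>)"
      using \<open>x \<le> y\<close>
    proof (induction y rule: int_ge_induct)
      case (step y)
      have "{x..<y + 1} = insert y {x..<y}" using step.hyps by auto
      then have "(\<Sum>v\<in>{x..<y + 1}. \<bar>f (csuc N v) - f v\<bar>)
          = \<bar>f (y + 1) - f y\<bar> + (\<Sum>v\<in>{x..<y}. \<bar>f (csuc N v) - f v\<bar>)"
        using step.prems by (simp add: csuc_def)
      with step show ?case by linarith
    qed simp
    also have "(\<Sum>v\<in>{x..<y}. \<bar>f (csuc N v) - f v\<bar>) \<le> (\<Sum>v\<in>vertices N. \<bar>f (csuc N v) - f v\<bar>)"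
      using that by (intro sum_mono2) (auto simp: vertices_def)
    finally show ?thesis using that by simp
  qed
  show ?thesis
  proof (cases "x \<le> y")
    case True
    with *[of x y] assms show ?thesis by (simp add: vertices_def abs_minus_commute)
  next
    case False
    with *[of y x] assms show ?thesis by (simp add: vertices_def)
  qed
qed

text \<open>For equal signs this is an equality. For opposite signs
  \<open>\<bar>a - b\<bar> = \<bar>a\<bar> + \<bar>b\<bar>\<close>, so the right side is a square
  that dominates \<open>a\<^sup>2 + b\<^sup>2\<close>.\<close>

lemma abs_signed_square_diff_le:
  fixes a b :: real
  shows "\<bar>a * \<bar>a\<bar> - b * \<bar>b\<bar>\<bar> \<le> \<bar>a - b\<bar> * (\<bar>a\<bar> + \<bar>b\<bar>)"
proof (cases "(0 \<le> a) = (0 \<le> b)")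
  case True
  then have "\<bar>a * \<bar>a\<bar> - b * \<bar>b\<bar>\<bar> = \<bar>(a - b) * (\<bar>a\<bar> + \<bar>b\<bar>)\<bar>"
    by (cases "0 \<le> a") (auto simp: algebra_simps abs_minus_commute)
  then show ?thesis by (simp add: abs_mult)
next
  case False
  have sq: "\<bar>a * a + b * b\<bar> = a * a + b * b" by (intro abs_of_nonneg sum_squares_ge_zero)
  have "\<bar>a * \<bar>a\<bar> - b * \<bar>b\<bar>\<bar> = \<bar>a * a + b * b\<bar>" "\<bar>a - b\<bar> = \<bar>a\<bar> + \<bar>b\<bar>"
    using False abs_minus_cancel[of "a * a + b * b"] by (auto simp: abs_of_neg not_le)
  moreover have "(\<bar>a\<bar> + \<bar>b\<bar>) * (\<bar>a\<bar> + \<bar>b\<bar>) = a * a + b * b + 2 * (\<bar>a\<bar> * \<bar>b\<bar>)"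
    by (simp add: algebra_simps)
  ultimately show ?thesis by (simp add: sq)
qed

text \<open>
  The signed square \<open>h \<bar>h\<bar>\<close> takes values of both signs, so it is bounded by its total variation
  around the circle, which Cauchy--Schwarz controls by the Dirichlet form.
\<close>

lemma circle_sup_bound:
  fixes h \<omega> :: "int \<Rightarrow> real"
  assumes \<omega>: "\<And>x. x \<in> vertices N \<Longrightarrow> 0 < \<omega> x" and mean: "(\<Sum>x\<in>vertices N. \<omega> x * h x) = 0"
    and z: "z \<in> vertices N"
  shows "(h z) ^ 4 \<le> 4 * (\<Sum>x\<in>vertices N. (h (csuc N x) - h x)\<^sup>2) * (\<Sum>x\<in>vertices N. (h x)\<^sup>2)"
proof -
  let ?V = "vertices N"
  define \<phi> where "\<phi> x = h x * \<bar>h x\<bar>" for x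
  have nonpos: "\<exists>x\<in>?V. h x \<le> 0"
  proof (rule ccontr)
    assume "\<not> ?thesis"
    then have "0 < (\<Sum>x\<in>?V. \<omega> x * h x)"
      using \<omega> z by (intro sum_pos) auto
    with mean show False by simp
  qed
  have nonneg: "\<exists>x\<in>?V. 0 \<le> h x"
  proof (rule ccontr)
    assume "\<not> ?thesis"
    then have "0 < (\<Sum>x\<in>?V. - (\<omega> x * h x))"
      using \<omega> z by (intro sum_pos) (auto simp: mult_less_0_iff)
    with mean show False by (simp add: sum_negf)
  qed
  obtain x y where xy: "x \<in> ?V" "h x \<le> 0" "y \<in> ?V" "0 \<le> h y"
    using nonpos nonneg by auto
  then have "\<phi> x \<le> 0" "0 \<le> \<phi> y" by (auto simp: \<phi>_def mult_le_0_iff)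
  \<comment> \<open>A positive \<open>\<phi> z\<close> is compared with the value at
    \<open>x\<close>, a negative one with the value at \<open>y\<close>.\<close>
  then have "\<bar>\<phi> z\<bar> \<le> (\<Sum>v\<in>?V. \<bar>\<phi> (csuc N v) - \<phi> v\<bar>)"
    using circle_variation_bound[OF z xy(1), of \<phi>] circle_variation_bound[OF z xy(3), of \<phi>] by linarith
  also have "\<dots> \<le> (\<Sum>v\<in>?V. \<bar>h (csuc N v) - h v\<bar> * (\<bar>h (csuc N v)\<bar> + \<bar>h v\<bar>))"
    unfolding \<phi>_def by (intro sum_mono abs_signed_square_diff_le)
  finally have "\<bar>\<phi> z\<bar>\<^sup>2 \<le> (\<Sum>v\<in>?V. \<bar>h (csuc N v) - h v\<bar> * (\<bar>h (csuc N v)\<bar> + \<bar>h v\<bar>))\<^sup>2"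
    by (intro power_mono) auto
  also have "\<dots> \<le> (\<Sum>v\<in>?V. \<bar>h (csuc N v) - h v\<bar>\<^sup>2) * (\<Sum>v\<in>?V. (\<bar>h (csuc N v)\<bar> + \<bar>h v\<bar>)\<^sup>2)"
    by (rule Cauchy_Schwarz_ineq_sum)
  also have "\<dots> \<le> (\<Sum>v\<in>?V. (h (csuc N v) - h v)\<^sup>2) * (4 * (\<Sum>v\<in>?V. (h v)\<^sup>2))"
  proof (intro mult_mono)
    have "(\<bar>a\<bar> + \<bar>b\<bar>)\<^sup>2 \<le> 2 * (a\<^sup>2 + b\<^sup>2)" for a b :: real
      using zero_le_power2[of "\<bar>a\<bar> - \<bar>b\<bar>"] by (simp add: power2_sum power2_diff)
    then have "(\<Sum>v\<in>?V. (\<bar>h (csuc N v)\<bar> + \<bar>h v\<bar>)\<^sup>2) \<le> (\<Sum>v\<in>?V. 2 * ((h (csuc N v))\<^sup>2 + (h v)\<^sup>2))"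
      by (intro sum_mono)
    also have "\<dots> = 4 * (\<Sum>v\<in>?V. (h v)\<^sup>2)"
      using sum_csuc[of "\<lambda>v. (h v)\<^sup>2" N] by (simp add: sum.distrib flip: sum_distrib_left)
    finally show "(\<Sum>v\<in>?V. (\<bar>h (csuc N v)\<bar> + \<bar>h v\<bar>)\<^sup>2) \<le> 4 * (\<Sum>v\<in>?V. (h v)\<^sup>2)" .
  qed (auto intro: sum_nonneg)
  also have "\<bar>\<phi> z\<bar>\<^sup>2 = (h z) ^ 4"
    by (simp add: \<phi>_def abs_mult power_mult_distrib flip: power_add)
  finally show ?thesis by (simp add: mult_ac)
qed

text \<open>With \<open>X\<close> the maximum of \<open>\<bar>h\<bar>\<close>, one has
  \<open>S \<le> X * A\<close>, while \<open>circle_sup_bound\<close> gives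
  \<open>X ^ 4 \<le> 4 * D * S\<close>. Taking the fourth power of the first and cancelling one
  factor \<open>S\<close> leaves the claim.\<close>

lemma circle_Nash:
  fixes h \<omega> :: "int \<Rightarrow> real"
  assumes \<omega>: "\<And>x. x \<in> vertices N \<Longrightarrow> 0 < \<omega> x" and mean: "(\<Sum>x\<in>vertices N. \<omega> x * h x) = 0"
  shows "(\<Sum>x\<in>vertices N. (h x)\<^sup>2) ^ 3
    \<le> 4 * (\<Sum>x\<in>vertices N. (h (csuc N x) - h x)\<^sup>2) * (\<Sum>x\<in>vertices N. \<bar>h x\<bar>) ^ 4"
proof -
  let ?V = "vertices N"
  define S where "S = (\<Sum>x\<in>?V. (h x)\<^sup>2)"
  define D where "D = (\<Sum>x\<in>?V. (h (csuc N x) - h x)\<^sup>2)"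
  define A where "A = (\<Sum>x\<in>?V. \<bar>h x\<bar>)"
  have nonneg: "0 \<le> S" "0 \<le> D" "0 \<le> A" by (auto simp: S_def D_def A_def intro!: sum_nonneg)
  show ?thesis unfolding S_def[symmetric] D_def[symmetric] A_def[symmetric]
  proof (cases "S = 0")
    case True
    then show "S ^ 3 \<le> 4 * D * A ^ 4" using nonneg by simp
  next
    case False
    then have "?V \<noteq> {}" by (auto simp: S_def)
    define X where "X = Max ((\<lambda>x. \<bar>h x\<bar>) ` ?V)"
    have "X \<in> (\<lambda>x. \<bar>h x\<bar>) ` ?V" unfolding X_def using \<open>?V \<noteq> {}\<close> by (intro Max_in) auto
    then obtain z where z: "z \<in> ?V" "X = \<bar>h z\<bar>" by auto
    have "(h x)\<^sup>2 \<le> X * \<bar>h x\<bar>" if "x \<in> ?V" for x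
    proof -
      have "\<bar>h x\<bar> \<le> X" unfolding X_def using that by (intro Max_ge) auto
      then have "\<bar>h x\<bar> * \<bar>h x\<bar> \<le> X * \<bar>h x\<bar>" by (intro mult_right_mono) auto
      then show ?thesis by (simp add: power2_eq_square)
    qed
    then have "S \<le> X * A" unfolding S_def A_def sum_distrib_left by (intro sum_mono)
    then have "S ^ 4 \<le> (X * A) ^ 4" using nonneg by (intro power_mono) auto
    also have "\<dots> = (h z) ^ 4 * A ^ 4" by (simp add: z power_mult_distrib)
    also have "\<dots> \<le> (4 * D * S) * A ^ 4"
      using circle_sup_bound[OF \<omega> mean z(1)] unfolding S_def D_def
      by (intro mult_right_mono) (auto simp: mult_ac)
    finally have "S * S ^ 3 \<le> S * (4 * D * A ^ 4)"
      by (simp add: power_Suc[symmetric] mult_ac eval_nat_numeral)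
    then show "S ^ 3 \<le> 4 * D * A ^ 4" using False nonneg by (simp add: mult_le_cancel_left)
  qed
qed

text \<open>Cauchy--Schwarz gives \<open>A\<^sup>2 \<le> N * S\<close> for the L1 norm
  \<open>A\<close>; inserted into the Nash inequality, it leaves a factor \<open>S\<^sup>2\<close>
  to cancel.\<close>

lemma circle_Poincare:
  fixes h \<omega> :: "int \<Rightarrow> real"
  assumes \<omega>: "\<And>x. x \<in> vertices N \<Longrightarrow> 0 < \<omega> x" and mean: "(\<Sum>x\<in>vertices N. \<omega> x * h x) = 0"
    and "0 \<le> N"
  shows "(\<Sum>x\<in>vertices N. (h x)\<^sup>2)
    \<le> 4 * (real_of_int N)\<^sup>2 * (\<Sum>x\<in>vertices N. (h (csuc N x) - h x)\<^sup>2)"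
proof -
  let ?V = "vertices N"
  define S where "S = (\<Sum>x\<in>?V. (h x)\<^sup>2)"
  define D where "D = (\<Sum>x\<in>?V. (h (csuc N x) - h x)\<^sup>2)"
  define A where "A = (\<Sum>x\<in>?V. \<bar>h x\<bar>)"
  have nonneg: "0 \<le> S" "0 \<le> D" by (auto simp: S_def D_def intro!: sum_nonneg)
  have "A\<^sup>2 \<le> real_of_int N * S"
    using Cauchy_Schwarz_ineq_sum[of "\<lambda>_. 1" "\<lambda>x. \<bar>h x\<bar>" ?V] \<open>0 \<le> N\<close>
    by (simp add: A_def S_def vertices_def)
  then have "(A\<^sup>2)\<^sup>2 \<le> (real_of_int N * S)\<^sup>2" by (intro power_mono) auto
  moreover have "S ^ 3 \<le> 4 * D * A ^ 4"
    using circle_Nash[OF \<omega> mean] by (simp add: S_def D_def A_def)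
  ultimately have "S ^ 3 \<le> 4 * D * (real_of_int N * S)\<^sup>2"
    using nonneg by (simp add: order_trans[OF _ mult_left_mono])
  then have "S\<^sup>2 * S \<le> S\<^sup>2 * (4 * (real_of_int N)\<^sup>2 * D)"
    by (simp add: power_mult_distrib power2_eq_square power3_eq_cube mult_ac)
  then have "S \<le> 4 * (real_of_int N)\<^sup>2 * D" if "S \<noteq> 0"
    using that by (simp add: mult_le_cancel_left)
  then have "S \<le> 4 * (real_of_int N)\<^sup>2 * D" using nonneg by (cases "S = 0") auto
  then show ?thesis by (simp add: S_def D_def)
qed

section \<open>The twisted kernel and its invariant measure\<close>

text \<open>The value \<open>x\<close> enters both equations, with the light weight for the minimum
  and with the heavy weight for the maximum; these weights differ by the factor
  \<open>1 + \<epsilon>\<close>. Absorbing the other terms shows that the heavy share is at least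
  \<open>M / 4\<close> and the light share at most \<open>m / 4\<close>.\<close>

lemma max_le_min_opposite:
  fixes \<epsilon> :: real
  assumes "\<epsilon> > 0"
    and m: "m = p / 2 + q / 4 + 1 / (2 * (2 + \<epsilon>)) * x" "m \<le> p" "m \<le> q"
    and M: "M = y / 2 + (1 + \<epsilon>) / (2 * (2 + \<epsilon>)) * x + z / 4" "y \<le> M" "z \<le> M"
  shows "M \<le> (1 + \<epsilon>) * m"
proof -
  let ?b = "1 / (2 * (2 + \<epsilon>))"
  have "M / 4 \<le> (1 + \<epsilon>) * (?b * x)" using M by simp
  also have "\<dots> \<le> (1 + \<epsilon>) * (m / 4)" using m assms(1) by (intro mult_left_mono) auto
  finally show ?thesis by simp
qed

text \<open>The equations share \<open>x\<close> and \<open>p\<close>. The first one bounds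
  \<open>p\<close> in terms of \<open>m\<close> and \<open>x\<close>, then \<open>y \<le> M\<close>
  and \<open>b * x \<le> m / 4\<close> yield \<open>b * M \<le> m / 4\<close>. This suffices because
  \<open>b * (1 + \<epsilon>) = 1 / 2 - b > 1 / 4\<close>.\<close>

lemma max_le_min_same:
  fixes \<epsilon> :: real
  assumes "\<epsilon> > 0" "0 < m"
    and m: "m = p / 2 + q / 4 + 1 / (2 * (2 + \<epsilon>)) * x" "m \<le> p" "m \<le> q"
    and M: "M = x / 2 + p / 4 + (1 + \<epsilon>) / (2 * (2 + \<epsilon>)) * y" "y \<le> M"
  shows "M \<le> (1 + \<epsilon>) * m"
proof -
  define b where "b = 1 / (2 * (2 + \<epsilon>))"
  have b: "(1 + \<epsilon>) / (2 * (2 + \<epsilon>)) = 1 / 2 - b" "0 < b" "b < 1 / 2" and \<epsilon>: "1 + \<epsilon> = 1 / (2 * b) - 1"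
    using assms(1) by (auto simp: b_def field_simps)
  have m': "m = p / 2 + q / 4 + b * x" using m(1) unfolding b_def .
  have bx: "b * x \<le> m / 4" using m' m(2,3) by linarith
  have "(1 / 2 - b) * y \<le> (1 / 2 - b) * M" using M(2) b by (intro mult_left_mono) auto
  then have "M \<le> x / 2 + p / 4 + (1 / 2 - b) * M" using M(1) unfolding b(1) by linarith
  moreover have "p \<le> 3 / 2 * m - 2 * (b * x)" using m' m(3) by linarith
  ultimately have "(1 / 2 + b) * M \<le> x * (1 - b) / 2 + 3 / 8 * m"
    by (simp add: field_simps)
  then have "b * ((1 / 2 + b) * M) \<le> b * (x * (1 - b) / 2 + 3 / 8 * m)"
    using b by (intro mult_left_mono) auto
  also have "\<dots> = (b * x) * ((1 - b) / 2) + 3 / 8 * (b * m)" by (simp add: algebra_simps)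
  also have "\<dots> \<le> (m / 4) * ((1 - b) / 2) + 3 / 8 * (b * m)"
    using bx b by (intro add_right_mono mult_right_mono) auto
  also have "\<dots> = (1 / 2 + b) * (m / 4)" by (simp add: field_simps)
  finally have "(1 / 2 + b) * (b * M) \<le> (1 / 2 + b) * (m / 4)"
    by (simp only: mult.left_commute[of b])
  then have "b * M \<le> m / 4" using b by (simp only: mult_le_cancel_left_pos)
  also have "\<dots> \<le> (1 / 2 - b) * m"
    using b(2) assms(1,2) mult_right_mono[of b "1 / 4" m] by (simp add: b_def field_simps)
  also have "\<dots> = b * ((1 + \<epsilon>) * m)" using b(2) unfolding \<epsilon> by (simp add: field_simps)
  finally show ?thesis using b(2) by simp
qed

text \<open>This serves \<open>N = 3\<close>, where the vertex 2 receives light weights from both 0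
  and 1. Only \<open>x + y\<close> and \<open>y\<close> remain after eliminating \<open>p\<close>,
  and the estimate comes down to \<open>(1 / 4 - b) * (1 - b) \<ge> 0\<close>.\<close>

lemma max_le_min_triangle:
  fixes \<epsilon> :: real
  assumes "\<epsilon> > 0" "0 < m"
    and m: "m = p / 2 + 1 / (2 * (2 + \<epsilon>)) * x + 1 / (2 * (2 + \<epsilon>)) * y" "m \<le> p" "m \<le> y"
    and M: "M = x / 2 + p / 4 + (1 + \<epsilon>) / (2 * (2 + \<epsilon>)) * y"
  shows "M \<le> (1 + \<epsilon>) * m"
proof -
  define b where "b = 1 / (2 * (2 + \<epsilon>))"
  have b: "(1 + \<epsilon>) / (2 * (2 + \<epsilon>)) = 1 / 2 - b" "0 < b" "b < 1 / 4" and \<epsilon>: "1 + \<epsilon> = 1 / (2 * b) - 1"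
    using assms(1) by (auto simp: b_def field_simps)
  define \<sigma> where "\<sigma> = x + y"
  have p: "p = 2 * m - 2 * (b * \<sigma>)" using m(1) unfolding b_def \<sigma>_def by argo
  have b\<sigma>: "b * \<sigma> \<le> m / 2" using p m(2) by linarith
  have "M = \<sigma> * (1 - b) / 2 + m / 2 - b * y"
    using p unfolding M[unfolded b(1)] \<sigma>_def by (simp add: field_simps)
  also have "\<dots> \<le> \<sigma> * (1 - b) / 2 + m / 2 - b * m" using m(3) b by simp
  finally have "b * M \<le> b * (\<sigma> * (1 - b) / 2 + m / 2 - b * m)" using b by (intro mult_left_mono) auto
  also have "\<dots> = (b * \<sigma>) * ((1 - b) / 2) + b * m / 2 - b * b * m" by (simp add: algebra_simps)
  also have "\<dots> \<le> (m / 2) * ((1 - b) / 2) + b * m / 2 - b * b * m"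
    using b\<sigma> b by (intro diff_right_mono add_right_mono mult_right_mono) auto
  also have "\<dots> = (1 / 4 + b / 4 - b * b) * m" by (simp add: field_simps)
  also have "\<dots> \<le> (1 / 2 - b) * m"
  proof (rule mult_right_mono)
    have "0 \<le> (1 / 4 - b) * (1 - b)" using b by (intro mult_nonneg_nonneg) auto
    moreover have "(1 / 4 - b) * (1 - b) = 1 / 4 - 5 / 4 * b + b * b" by (simp add: field_simps)
    ultimately show "1 / 4 + b / 4 - b * b \<le> 1 / 2 - b" by linarith
  qed (use assms in auto)
  also have "(1 / 2 - b) * m = b * ((1 + \<epsilon>) * m)"
    using b unfolding \<epsilon> by (simp add: field_simps)
  finally show ?thesis using b by simp
qed

section \<open>The twisted chain and its positivity\<close>

locale circle_chain =
  fixes \<epsilon> :: real and N :: int and g :: "int \<Rightarrow> int"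
  assumes eps_pos: "0 < \<epsilon>" and N_ge_3: "3 \<le> N" and g_permutes: "g permutes vertices N"
begin

abbreviation V :: "int set" where "V \<equiv> vertices N"

abbreviation K :: "int \<Rightarrow> int \<Rightarrow> real" where
  "K \<equiv> twisted_kernel (circle_kernel \<epsilon> N) g"

text \<open>Outgoing weights towards \<open>csuc\<close>, and in \<open>down\<close> towards
  \<open>cpred\<close>: heavy along the edge between 0 and 1, light on the steps from 0 and 1 away
  from that edge.\<close>

definition up :: "int \<Rightarrow> real" where
  "up x = (if x = 0 then (1 + \<epsilon>) / (2 * (2 + \<epsilon>)) else if x = 1 then 1 / (2 * (2 + \<epsilon>)) else 1 / 4)"

definition down :: "int \<Rightarrow> real" where
  "down x = (if x = 0 then 1 / (2 * (2 + \<epsilon>)) else if x = 1 then (1 + \<epsilon>) / (2 * (2 + \<epsilon>)) else 1 / 4)"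

lemma weight_eq: "(1 + \<epsilon>) / (2 * (2 + \<epsilon>)) = 1 / 2 - 1 / (2 * (2 + \<epsilon>))"
  and weight_bounds: "0 < 1 / (2 * (2 + \<epsilon>))" "1 / (2 * (2 + \<epsilon>)) < 1 / 4"
  using eps_pos by (auto simp: field_simps)

lemma up_add_down: "up x + down x = 1 / 2"
  unfolding up_def down_def weight_eq by simp

lemma up_ge: "1 / (2 * (2 + \<epsilon>)) \<le> up x" and down_ge: "1 / (2 * (2 + \<epsilon>)) \<le> down x"
  using weight_bounds unfolding up_def down_def weight_eq by auto

lemma up_pos: "0 < up x" and down_pos: "0 < down x"
  using up_ge[of x] down_ge[of x] weight_bounds(1) by linarith+

lemma V_ne: "V \<noteq> {}" and vertices_in: "0 \<in> V" "1 \<in> V" "2 \<in> V" "N - 1 \<in> V" "N - 2 \<in> V"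
  using N_ge_3 by (auto simp: vertices_def)

lemma g_in: "x \<in> V \<Longrightarrow> g x \<in> V" and bij_g: "bij_betw g V V"
  using g_permutes by (auto simp: permutes_in_image permutes_imp_bij)

lemma circle_adj_iff:
  assumes "x \<in> V" "u \<in> V"
  shows "circle_adj N x u \<longleftrightarrow> u = csuc N x \<or> u = cpred N x"
proof -
  have "d mod N = (if 0 \<le> d then d else d + N)" if "- N < d" "d < N" for d
  proof (cases "0 \<le> d")
    case False
    have "d mod N = (d + N) mod N" by simp
    also have "\<dots> = d + N" using that False by (intro mod_pos_pos_trivial) auto
    finally show ?thesis using False by simp
  qed (use that in simp)
  from this[of "x - u"] this[of 1] this[of "-1"] show ?thesis
    using assms N_ge_3 unfolding circle_adj_def
    by (auto simp: vertices_def csuc_def cpred_def split: if_splits)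
qed

text \<open>For \<open>N \<ge> 3\<close> a vertex and its two neighbours are distinct, so at most
  one summand is nonzero. In this form the kernel can be summed term by term over either
  argument.\<close>

lemma circle_kernel_eq:
  assumes "x \<in> V" "u \<in> V"
  shows "circle_kernel \<epsilon> N x u = (if u = x then 1 / 2 else 0)
    + (if u = csuc N x then up x else 0) + (if u = cpred N x then down x else 0)"
proof -
  have neq: "csuc N x \<noteq> x" "cpred N x \<noteq> x" "csuc N x \<noteq> cpred N x"
    using assms N_ge_3 by (auto simp: csuc_def cpred_def vertices_def)
  have last: "(-1) mod N = N - 1" using N_ge_3 by (simp add: zmod_minus1)
  have low: "csuc N 0 = 1" "cpred N 0 = N - 1" "csuc N 1 = 2" "cpred N 1 = 0"
    using N_ge_3 by (auto simp: csuc_def cpred_def)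
  consider "x = 0" | "x = 1" | "x \<notin> {0, 1}" by auto
  then show ?thesis
  proof cases
    case 1
    show ?thesis using neq N_ge_3
      unfolding circle_kernel_def circle_adj_iff[OF assms] 1 low last up_def down_def by simp
  next
    case 2
    show ?thesis using neq N_ge_3
      unfolding circle_kernel_def circle_adj_iff[OF assms] 2 low last up_def down_def by simp
  next
    case 3
    then show ?thesis using neq
      unfolding circle_kernel_def circle_adj_iff[OF assms] last up_def down_def by auto
  qed
qed

lemma circle_kernel_apply:
  assumes "x \<in> V"
  shows "(\<Sum>u\<in>V. circle_kernel \<epsilon> N x u * h u)
    = h x / 2 + up x * h (csuc N x) + down x * h (cpred N x)"
proof -
  have "(\<Sum>u\<in>V. circle_kernel \<epsilon> N x u * h u) = (\<Sum>u\<in>V. (if u = x then h x / 2 else 0)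
    + (if u = csuc N x then up x * h (csuc N x) else 0)
    + (if u = cpred N x then down x * h (cpred N x) else 0))"
    by (rule sum.cong) (auto simp: circle_kernel_eq[OF assms] algebra_simps)
  then show ?thesis using assms by (simp add: sum.distrib)
qed

lemma circle_kernel_push:
  assumes "u \<in> V"
  shows "(\<Sum>x\<in>V. \<mu> x * circle_kernel \<epsilon> N x u)
    = \<mu> u / 2 + up (cpred N u) * \<mu> (cpred N u) + down (csuc N u) * \<mu> (csuc N u)"
proof -
  have "\<mu> x * circle_kernel \<epsilon> N x u = (if x = u then \<mu> u / 2 else 0)
    + (if x = cpred N u then up (cpred N u) * \<mu> (cpred N u) else 0)
    + (if x = csuc N u then down (csuc N u) * \<mu> (csuc N u) else 0)" if "x \<in> V" for x
  proof -
    have "u = csuc N x \<longleftrightarrow> x = cpred N u" "u = cpred N x \<longleftrightarrow> x = csuc N u" "u = x \<longleftrightarrow> x = u"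
      using assms that by auto
    then show ?thesis
      unfolding circle_kernel_eq[OF that assms] by (simp only:) (simp add: distrib_left)
  qed
  then have "(\<Sum>x\<in>V. \<mu> x * circle_kernel \<epsilon> N x u) = (\<Sum>x\<in>V. (if x = u then \<mu> u / 2 else 0)
    + (if x = cpred N u then up (cpred N u) * \<mu> (cpred N u) else 0)
    + (if x = csuc N u then down (csuc N u) * \<mu> (csuc N u) else 0))"
    by (rule sum.cong[OF refl])
  then show ?thesis using assms by (simp add: sum.distrib)
qed

text \<open>Reindexing by \<open>y = g u\<close> cancels \<open>inv g\<close>: the twisted chain
  makes one circle step and then applies \<open>g\<close>.\<close>

lemma twisted_apply:
  assumes "x \<in> V"
  shows "(\<Sum>y\<in>V. K x y * f y)
    = f (g x) / 2 + up x * f (g (csuc N x)) + down x * f (g (cpred N x))"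
proof -
  have "(\<Sum>y\<in>V. K x y * f y) = (\<Sum>u\<in>V. K x (g u) * f (g u))"
    by (rule sum.reindex_bij_betw[OF bij_g, symmetric])
  also have "\<dots> = (\<Sum>u\<in>V. circle_kernel \<epsilon> N x u * f (g u))"
    by (simp add: twisted_kernel_def permutes_inverses[OF g_permutes])
  finally show ?thesis using circle_kernel_apply[OF assms, of "\<lambda>u. f (g u)"] by simp
qed

lemma stochastic_K: "stochastic V K"
  unfolding stochastic_def
proof (intro conjI ballI)
  fix x y assume xy: "x \<in> V" "y \<in> V"
  then have "inv g y \<in> V" using permutes_in_image[OF permutes_inv[OF g_permutes]] by simp
  with xy show "0 \<le> K x y"
    by (simp add: twisted_kernel_def circle_kernel_eq up_pos down_pos less_imp_le)
next
  fix x assume "x \<in> V"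
  then show "(\<Sum>y\<in>V. K x y) = 1"
    using twisted_apply[of x "\<lambda>_. 1"] up_add_down[of x] by simp
qed

text \<open>The set of starts that reach \<open>z\<close> in \<open>n\<close> steps gains at least
  one vertex per step until it is all of \<open>V\<close>, by \<open>cpred_expansion\<close>;
  relabelling by \<open>g\<close> keeps its cardinality.\<close>

lemma kernel_power_positive:
  assumes "x \<in> V" "z \<in> V"
  shows "0 < kernel_power V K (nat N) x z"
proof -
  define Z where "Z n = {x\<in>V. 0 < kernel_power V K n x z}" for n
  have card: "min (n + 1) (nat N) \<le> card (Z n)" for n
  proof (induction n)
    case 0
    have "Z 0 = {z}" using assms by (auto simp: Z_def)
    then show ?case by simp
  next
    case (Suc n)
    define S where "S = {u\<in>V. g u \<in> Z n}"
    have "g ` S = Z n"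
    proof
      show "Z n \<subseteq> g ` S"
      proof
        fix y assume y: "y \<in> Z n"
        then have "y \<in> g ` V" using permutes_image[OF g_permutes] by (auto simp: Z_def)
        with y show "y \<in> g ` S" by (auto simp: S_def)
      qed
    qed (auto simp: S_def)
    moreover have "inj_on g S" using permutes_inj[OF g_permutes] inj_on_subset by blast
    ultimately have cardS: "card S = card (Z n)" using card_image[of g S] by simp
    have S: "S \<subseteq> V" by (auto simp: S_def)
    have "card (Z n) \<noteq> 0" using Suc N_ge_3 by auto
    then have "S \<noteq> {}" using cardS by auto
    have nn: "0 \<le> kernel_power V K n (g x) z" if "x \<in> V" for x
      using stochastic_nonneg[OF stochastic_kernel_power[OF finite_vertices stochastic_K]] g_in[OF that]
        assms(2) .
    \<comment> \<open>Holding or moving up is enough to land in \<open>S\<close>; of the step down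
      only nonnegativity is used.\<close>
    have *: "x \<in> Z (Suc n)" if x: "x \<in> V" and "x \<in> S \<or> csuc N x \<in> S" for x
    proof -
      let ?f = "\<lambda>u. kernel_power V K n (g u) z"
      have "0 \<le> ?f x" "0 \<le> ?f (csuc N x)" "0 \<le> down x * ?f (cpred N x)"
        using nn x down_pos[of x] by auto
      moreover have "0 < ?f x \<or> 0 < ?f (csuc N x)" using that by (auto simp: S_def Z_def)
      ultimately have "0 < ?f x / 2 + up x * ?f (csuc N x) + down x * ?f (cpred N x)"
        using up_pos[of x] by (smt (verit) mult_pos_pos mult_nonneg_nonneg half_gt_zero divide_nonneg_pos)
      then show ?thesis
        using x assms(2) by (simp only: Z_def mem_Collect_eq
          kernel_power_Suc_left[OF finite_vertices x assms(2)] twisted_apply[OF x] simp_thms)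
    qed
    show ?case
    proof (cases "S = V")
      case True
      then have "V \<subseteq> Z (Suc n)" using * by auto
      then have "card V \<le> card (Z (Suc n))" by (intro card_mono) (auto simp: Z_def)
      then show ?thesis by (simp add: vertices_def)
    next
      case False
      have "\<not> card (Z (Suc n)) \<le> card S"
      proof
        assume le: "card (Z (Suc n)) \<le> card S"
        have "Z (Suc n) \<subseteq> V" by (auto simp: Z_def)
        from cpred_expansion[OF S this le \<open>S \<noteq> {}\<close> False]
        obtain x where "x \<in> S" "x \<notin> Z (Suc n) \<or> cpred N x \<notin> Z (Suc n)" by auto
        then show False using *[of x] *[of "cpred N x"] S by auto
      qed
      then show ?thesis using Suc cardS by linarith
    qed
  qed
  have "Z (nat N) = V"
  proof (rule card_seteq)
    show "card V \<le> card (Z (nat N))" using card[of "nat N"] by (simp add: vertices_def)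
  qed (auto simp: Z_def)
  then show ?thesis using assms(1) by (auto simp: Z_def)
qed

section \<open>The ratio bound for the invariant measure\<close>

lemma invariant_unique: "\<exists>!\<pi>. invariant_prob V K \<pi>"
  using invariant_prob_exists_unique[OF finite_vertices V_ne stochastic_K _ kernel_power_positive]
    N_ge_3 by simp

lemma invariant_pos: "invariant_prob V K \<pi> \<Longrightarrow> x \<in> V \<Longrightarrow> 0 < \<pi> x"
  by (rule invariant_prob_pos[OF finite_vertices stochastic_K _ kernel_power_positive])

text \<open>At \<open>g u\<close> the inverse permutation cancels, so \<open>\<pi>\<close> composed
  with \<open>g\<close> is the push-forward of \<open>\<pi>\<close> under the circle kernel.\<close>

lemma invariant_push:
  assumes "invariant_prob V K \<pi>" "u \<in> V"
  shows "\<pi> u / 2 + up (cpred N u) * \<pi> (cpred N u) + down (csuc N u) * \<pi> (csuc N u) = \<pi> (g u)"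
proof -
  have "(\<Sum>x\<in>V. \<pi> x * K x (g u)) = \<pi> (g u)"
    using assms g_in by (auto simp: invariant_prob_def)
  then show ?thesis
    using circle_kernel_push[OF assms(2), of \<pi>]
    by (simp add: twisted_kernel_def permutes_inverses[OF g_permutes])
qed

lemma card_twisted_level: "card {u\<in>V. \<pi> (g u) = c} = card {x\<in>V. \<pi> x = c}"
proof -
  have "bij_betw g {u\<in>V. \<pi> (g u) = c} {x\<in>V. \<pi> x = c}"
    using bij_g unfolding bij_betw_def by (auto simp: inj_on_def image_iff)
  then show ?thesis by (rule bij_betw_same_card)
qed

text \<open>
  Away from \<open>-1, 0, 1, 2\<close> the kernel averages symmetrically, so a level set of an extreme value
  avoiding those vertices would expand under the neighbourhood map, although \<open>g\<close> preserves its
  cardinality.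
\<close>

lemma level_set_expansion:
  assumes "c \<in> \<pi> ` V" and "x0 \<in> V" "\<pi> (g x0) \<noteq> c"
  shows "\<exists>u\<in>V. \<pi> (g u) = c \<and> (\<pi> u \<noteq> c \<or> \<pi> (cpred N u) \<noteq> c)"
proof -
  let ?S = "{u\<in>V. \<pi> (g u) = c}" and ?T = "{x\<in>V. \<pi> x = c}"
  have "?T \<noteq> {}" using assms(1) by auto
  then have "card ?T \<noteq> 0" by (simp add: card_eq_0_iff)
  then have "?S \<noteq> {}" using card_twisted_level[of \<pi> c] by (metis card.empty)
  moreover have "?S \<noteq> V" using assms by auto
  ultimately show ?thesis
    using cpred_expansion[of ?S N ?T] card_twisted_level[of \<pi> c] by auto
qed

lemma invariant_max_le_min:
  assumes \<pi>: "invariant_prob V K \<pi>"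
  shows "Max (\<pi> ` V) \<le> (1 + \<epsilon>) * Min (\<pi> ` V)"
proof -
  define M where "M = Max (\<pi> ` V)"
  define m where "m = Min (\<pi> ` V)"
  have Mi: "M \<in> \<pi> ` V" and mi: "m \<in> \<pi> ` V" using V_ne by (auto simp: M_def m_def)
  have leM: "\<pi> x \<le> M" and mle: "m \<le> \<pi> x" if "x \<in> V" for x
    using that by (auto simp: M_def m_def)
  have m0: "0 < m" using mi invariant_pos[OF \<pi>] by auto
  have M0: "0 < M" using Mi invariant_pos[OF \<pi>] by auto
  define a where "a = (1 + \<epsilon>) / (2 * (2 + \<epsilon>))"
  define b where "b = 1 / (2 * (2 + \<epsilon>))"
  have ab: "a = 1 / 2 - b" "1 / 4 < a" "0 < b" "b < 1 / 4"
    using eps_pos by (auto simp: a_def b_def field_simps)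
  note inv = invariant_push[OF \<pi>]
  have ge: "w * m \<le> w * \<pi> x" and le: "w * \<pi> x \<le> w * M" if "x \<in> V" "0 < w" for w x
    using mle[OF that(1)] leM[OF that(1)] that(2) by auto
  have i0: "\<pi> (g 0) = \<pi> 0 / 2 + \<pi> (N - 1) / 4 + a * \<pi> 1"
    and i1: "\<pi> (g 1) = \<pi> 1 / 2 + a * \<pi> 0 + \<pi> 2 / 4"
    using inv[of 0] inv[of 1] vertices_in N_ge_3 by (auto simp: csuc_def cpred_def up_def down_def a_def)
  have i2: "\<pi> (g 2) = \<pi> 2 / 2 + b * \<pi> 1 + down (csuc N 2) * \<pi> (csuc N 2)"
    and iN: "\<pi> (g (N - 1)) = \<pi> (N - 1) / 2 + up (N - 2) * \<pi> (N - 2) + b * \<pi> 0"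
    using inv[of 2] inv[of "N - 1"] vertices_in N_ge_3 by (auto simp: csuc_def cpred_def up_def down_def b_def)
  have inner: "\<pi> (g u) = \<pi> u / 2 + \<pi> (cpred N u) / 4 + \<pi> (csuc N u) / 4"
    if "u \<in> V" "u \<notin> {0, 1, 2, N - 1}" for u
    using inv[OF that(1)] that by (auto simp: vertices_def csuc_def cpred_def up_def down_def)
  have w14: "0 < up (N - 2)" "up (N - 2) \<le> 1 / 4" "0 < down (csuc N 2)" "down (csuc N 2) \<le> 1 / 4"
    using ab N_ge_3 up_pos down_pos by (auto simp: up_def down_def csuc_def b_def)
  have "am \<le> a * \<pi> x \<and> a * \<pi> x \<le> a * M \<and> b * m \<le> b * \<pi> x \<and> b * \<pi> x \<le> b * M"
    if "x \<in> V" "am = a * m" for x am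
    using ge[of x a] le[of x a] ge[of x b] le[of x b] that ab by auto
  note bounds = this[OF _ refl]
  \<comment> \<open>The incoming weights total \<open>3 / 4 + a > 1\<close> at 0 and 1, and at most
    \<open>3 / 4 + b < 1\<close> at 2 and -1. Hence the push-forward exceeds \<open>m\<close> at the
    former and stays below \<open>M\<close> at the latter.\<close>
  have am: "m / 4 < a * m" and bM: "b * M < M / 4" using ab m0 M0 by auto
  have ne0: "\<pi> (g 0) \<noteq> m" "\<pi> (g 1) \<noteq> m"
    using i0 i1 am bounds[of 0] bounds[of 1] mle[of 0] mle[of 1] mle[of 2] mle[of "N - 1"] vertices_in
    by linarith+
  have s2: "csuc N 2 \<in> V" using vertices_in by simp
  have "w * \<pi> x \<le> M / 4" if "x \<in> V" "0 < w" "w \<le> 1 / 4" for w x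
    using le[OF that(1,2)] mult_right_mono[OF that(3), of M] M0 by linarith
  from this[OF vertices_in(5) w14(1,2)] this[OF s2 w14(3,4)]
  have ne2: "\<pi> (g 2) \<noteq> M" "\<pi> (g (N - 1)) \<noteq> M"
    using i2 iN bM bounds[of 0] bounds[of 1] leM[of 2] leM[of "N - 1"] vertices_in M0
    by linarith+
  have min_at: "\<pi> (g 2) = m \<or> \<pi> (g (N - 1)) = m"
  proof (rule ccontr)
    assume ne: "\<not> ?thesis"
    \<comment> \<open>Away from the four exceptional vertices \<open>\<pi> (g u)\<close> would be an
      average, with positive weights, of values at least \<open>m\<close> that are not all
      \<open>m\<close>.\<close>
    obtain u where u: "u \<in> V" "\<pi> (g u) = m" "\<pi> u \<noteq> m \<or> \<pi> (cpred N u) \<noteq> m"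
      using level_set_expansion[OF mi vertices_in(1) ne0(1)] by auto
    then have "u \<notin> {0, 1, 2, N - 1}" using ne ne0 by auto
    from inner[OF u(1) this] u mle[OF u(1)] mle[OF cpred_in[OF u(1)]] mle[OF csuc_in[OF u(1)]]
    show False by linarith
  qed
  have max_at: "\<pi> (g 0) = M \<or> \<pi> (g 1) = M"
  proof (rule ccontr)
    assume ne: "\<not> ?thesis"
    obtain u where u: "u \<in> V" "\<pi> (g u) = M" "\<pi> u \<noteq> M \<or> \<pi> (cpred N u) \<noteq> M"
      using level_set_expansion[OF Mi vertices_in(3) ne2(1)] by auto
    then have "u \<notin> {0, 1, 2, N - 1}" using ne ne2 by auto
    from inner[OF u(1) this] u leM[OF u(1)] leM[OF cpred_in[OF u(1)]] leM[OF csuc_in[OF u(1)]]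
    show False by linarith
  qed
  have "M \<le> (1 + \<epsilon>) * m"
  \<comment> \<open>For \<open>N = 3\<close> the vertices 2 and -1 coincide, and both edges into
    that vertex are light.\<close>
  proof (cases "N = 3")
    case True
    then have min: "m = \<pi> 2 / 2 + b * \<pi> 1 + b * \<pi> 0"
      using min_at i2 by (auto simp: csuc_def down_def b_def)
    from max_at show ?thesis
    proof
      assume "\<pi> (g 0) = M"
      then show ?thesis
        using max_le_min_triangle[OF eps_pos m0, of "\<pi> 2" "\<pi> 0" "\<pi> 1" M] min i0 mle vertices_in True
        by (simp add: a_def b_def)
    next
      assume "\<pi> (g 1) = M"
      then show ?thesis
        using max_le_min_triangle[OF eps_pos m0, of "\<pi> 2" "\<pi> 1" "\<pi> 0" M] min i1 mle vertices_in True
        by (simp add: a_def b_def)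
    qed
  next
    case False
    then have N4: "N \<ge> 4" using N_ge_3 by simp
    then have "3 \<in> V" by (simp add: vertices_def)
    have j2: "\<pi> (g 2) = \<pi> 2 / 2 + b * \<pi> 1 + \<pi> 3 / 4"
      and jN: "\<pi> (g (N - 1)) = \<pi> (N - 1) / 2 + \<pi> (N - 2) / 4 + b * \<pi> 0"
      using i2 iN N4 by (auto simp: csuc_def up_def down_def)
    note V = vertices_in \<open>3 \<in> V\<close>
    \<comment> \<open>The reflection \<open>x \<mapsto> 1 - x\<close> swaps 0 with 1 and 2 with -1,
      so the four pairings are two cases up to symmetry: extremes at neighbouring vertices, or on
      opposite sides of the heavy edge.\<close>
    from min_at max_at show ?thesis
    proof (elim disjE)
      assume "\<pi> (g 2) = m" "\<pi> (g 0) = M"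
      then show ?thesis using i0 j2 mle leM V
        by (intro max_le_min_opposite[OF eps_pos, of m "\<pi> 2" "\<pi> 3" "\<pi> 1" M "\<pi> 0" "\<pi> (N - 1)"])
          (auto simp: a_def b_def)
    next
      assume "\<pi> (g 2) = m" "\<pi> (g 1) = M"
      then show ?thesis using i1 j2 mle leM V
        by (intro max_le_min_same[OF eps_pos m0, of "\<pi> 2" "\<pi> 3" "\<pi> 1" M "\<pi> 0"])
          (auto simp: a_def b_def)
    next
      assume "\<pi> (g (N - 1)) = m" "\<pi> (g 0) = M"
      then show ?thesis using i0 jN mle leM V
        by (intro max_le_min_same[OF eps_pos m0, of "\<pi> (N - 1)" "\<pi> (N - 2)" "\<pi> 0" M "\<pi> 1"])
          (auto simp: a_def b_def)
    next
      assume "\<pi> (g (N - 1)) = m" "\<pi> (g 1) = M"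
      then show ?thesis using i1 jN mle leM V
        by (intro max_le_min_opposite[OF eps_pos, of m "\<pi> (N - 1)" "\<pi> (N - 2)" "\<pi> 0" M "\<pi> 1" "\<pi> 2"])
          (auto simp: a_def b_def)
    qed
  qed
  then show ?thesis by (simp add: M_def m_def)
qed

end

section \<open>Merging\<close>

text \<open>A discrete form of \<open>w' = - k * w ^ 3\<close>, whose solutions satisfy
  \<open>w\<^sup>2 \<le> 1 / (2 * k * t)\<close>. The induction rests on
  \<open>(1 + 2 * y) * (1 - y)\<^sup>2 \<le> 1\<close> for \<open>y\<close> in the unit
  interval.\<close>

lemma cubic_recursion_decay:
  fixes w :: "nat \<Rightarrow> real"
  assumes nonneg: "\<And>n. 0 \<le> w n" and "0 < k" and rec: "\<And>n. w (Suc n) \<le> w n - k * (w n) ^ 3"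
  shows "2 * k * real n * (w n)\<^sup>2 \<le> 1"
proof (induction n)
  case (Suc n)
  show ?case
  proof (cases "w n = 0")
    case True
    then have "w (Suc n) = 0" using rec[of n] nonneg[of "Suc n"] by simp
    then show ?thesis by simp
  next
    case False
    define y where "y = k * (w n)\<^sup>2"
    have w0: "0 < w n" using False nonneg[of n] by simp
    have le: "w (Suc n) \<le> w n * (1 - y)"
      using rec[of n] by (simp add: y_def power2_eq_square power3_eq_cube algebra_simps)
    then have "0 \<le> w n * (1 - y)" using nonneg[of "Suc n"] by linarith
    then have y1: "y \<le> 1" using w0 by (simp add: zero_le_mult_iff)
    have y0: "0 \<le> y" using \<open>0 < k\<close> by (simp add: y_def)
    have "2 * k * real (Suc n) * (w (Suc n))\<^sup>2 \<le> 2 * k * real (Suc n) * (w n * (1 - y))\<^sup>2"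
      using le nonneg[of "Suc n"] \<open>0 < k\<close> by (intro mult_left_mono power_mono) auto
    also have "\<dots> = (2 * k * real n * (w n)\<^sup>2 + 2 * (k * (w n)\<^sup>2)) * (1 - y)\<^sup>2"
      unfolding power_mult_distrib by (simp add: algebra_simps)
    also have "\<dots> \<le> (1 + 2 * y) * (1 - y)\<^sup>2"
      using Suc.IH by (intro mult_right_mono) (auto simp: y_def)
    also have "\<dots> = 1 - y\<^sup>2 * (3 - 2 * y)"
      by (simp add: power2_eq_square algebra_simps)
    also have "\<dots> \<le> 1" using y0 y1 by simp
    finally show ?thesis .
  qed
qed simp

lemma geometric_recursion_decay:
  fixes w :: "nat \<Rightarrow> real"
  assumes nonneg: "\<And>n. 0 \<le> w n" and rec: "\<And>n. w (Suc n) \<le> (1 - q) * w n"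
  shows "w (m + n) \<le> exp (- q * real n) * w m"
proof (induction n)
  case (Suc n)
  have "w (m + Suc n) \<le> (1 - q) * w (m + n)" using rec[of "m + n"] by simp
  also have "\<dots> \<le> exp (- q) * w (m + n)"
    using exp_ge_add_one_self[of "- q"] nonneg by (intro mult_right_mono) auto
  also have "\<dots> \<le> exp (- q) * (exp (- q * real n) * w m)"
    using Suc by (intro mult_left_mono) auto
  also have "\<dots> = exp (- q * real (Suc n)) * w m"
    unfolding mult.assoc[symmetric] exp_add[symmetric] by (simp add: distrib_left)
  finally show ?case .
qed simp

text \<open>The total dissipation over \<open>k\<close> steps is at most \<open>w m\<close>, so some
  step dissipates no more than the average.\<close>

lemma telescoping_pigeonhole:
  fixes w D :: "nat \<Rightarrow> real"
  assumes "\<And>n. 0 \<le> w n" "\<And>n. w (Suc n) \<le> w n - c * D n" "0 < k"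
  shows "\<exists>j<k. real k * (c * D (m + j)) \<le> w m"
proof (rule ccontr)
  assume "\<not> ?thesis"
  then have *: "w m / real k < c * D (m + j)" if "j < k" for j
    using that \<open>0 < k\<close> by (auto simp: not_le field_simps)
  have "w (m + i) \<le> w m - (\<Sum>j<i. c * D (m + j))" for i
  proof (induction i)
    case (Suc i)
    then show ?case using assms(2)[of "m + i"] by simp
  qed simp
  from this[of k] have "(\<Sum>j<k. c * D (m + j)) \<le> w m" using assms(1)[of "m + k"] by linarith
  moreover have "(\<Sum>j<k. w m / real k) < (\<Sum>j<k. c * D (m + j))"
    using * \<open>0 < k\<close> by (intro sum_strict_mono) auto
  ultimately show False using \<open>0 < k\<close> by simp
qed

text \<open>Half the smallest edge weight, divided by the factor \<open>1 + \<epsilon>\<close> lost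
  in replacing \<open>\<pi>\<close> by the uniform measure.\<close>

definition dissipation :: "real \<Rightarrow> real" where
  "dissipation \<epsilon> = 1 / (4 * (2 + \<epsilon>) * (1 + \<epsilon>))"

text \<open>The coefficient of the cubic recursion: \<open>2 * (1 + \<epsilon>)\<^sup>2\<close>
  bounds the L1 norm in the Nash inequality, and the cube comes from comparing weighted and
  unweighted energies.\<close>

definition nash_rate :: "real \<Rightarrow> real" where
  "nash_rate \<epsilon> = dissipation \<epsilon> / (4 * (2 * (1 + \<epsilon>)\<^sup>2) ^ 4 * (1 + \<epsilon>) ^ 3)"

text \<open>The relative energy loss per step from the Poincare inequality, multiplied by
  \<open>N\<^sup>2\<close>.\<close>

definition spectral_rate :: "real \<Rightarrow> real" where
  "spectral_rate \<epsilon> = dissipation \<epsilon> / (4 * (1 + \<epsilon>))"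

text \<open>Bounds the fourth power of the relative error before exponential decay sets in; the
  fourth power is that of \<open>circle_sup_bound\<close>.\<close>

definition merging_const :: "real \<Rightarrow> real" where
  "merging_const \<epsilon> = 2 * (1 + \<epsilon>) ^ 5 / (dissipation \<epsilon> * nash_rate \<epsilon>)"

lemma rates_pos:
  assumes "0 < \<epsilon>"
  shows "0 < dissipation \<epsilon>" "0 < nash_rate \<epsilon>" "0 < spectral_rate \<epsilon>" "0 < merging_const \<epsilon>"
  using assms by (auto simp: dissipation_def nash_rate_def spectral_rate_def merging_const_def)

section \<open>Energy decay and the relative error\<close>

locale circle_chain_invariant = circle_chain +
  fixes \<pi> :: "int \<Rightarrow> real"
  assumes invariant: "invariant_prob V K \<pi>"
begin

lemma pi_sum: "(\<Sum>x\<in>V. \<pi> x) = 1"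
  using invariant by (simp add: invariant_prob_def)

lemma N_pos: "0 < real_of_int N"
  using N_ge_3 by simp

text \<open>The mean of \<open>\<pi>\<close> over \<open>V\<close> is \<open>1 / N\<close>, which
  lies between its minimum and maximum; the ratio bound does the rest.\<close>

lemma pi_lower: "x \<in> V \<Longrightarrow> 1 \<le> (1 + \<epsilon>) * (real_of_int N * \<pi> x)"
  and pi_upper: "x \<in> V \<Longrightarrow> real_of_int N * \<pi> x \<le> 1 + \<epsilon>"
proof -
  define M where "M = Max (\<pi> ` V)"
  define m where "m = Min (\<pi> ` V)"
  have ratio: "M \<le> (1 + \<epsilon>) * m"
    using invariant_max_le_min[OF invariant] by (simp add: M_def m_def)
  have leM: "\<pi> x \<le> M" and mle: "m \<le> \<pi> x" if "x \<in> V" for x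
    using that by (auto simp: M_def m_def)
  have card: "real (card V) = real_of_int N" using N_ge_3 by (simp add: vertices_def)
  have M: "1 \<le> real_of_int N * M"
    using sum_bounded_above[of V \<pi> M] leM pi_sum card by simp
  have m: "real_of_int N * m \<le> 1"
    using sum_bounded_below[of V m \<pi>] mle pi_sum card by simp
  {
    assume x: "x \<in> V"
    have "1 \<le> real_of_int N * M" by (rule M)
    also have "\<dots> \<le> real_of_int N * ((1 + \<epsilon>) * \<pi> x)"
      using ratio mle[OF x] eps_pos N_pos
      by (intro mult_left_mono order_trans[OF ratio] mult_left_mono) auto
    finally show "1 \<le> (1 + \<epsilon>) * (real_of_int N * \<pi> x)" by (simp add: mult_ac)
    have "real_of_int N * \<pi> x \<le> real_of_int N * ((1 + \<epsilon>) * m)"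
      using leM[OF x] ratio N_pos by (intro mult_left_mono) auto
    also have "\<dots> \<le> (1 + \<epsilon>) * 1"
      using mult_left_mono[OF m, of "1 + \<epsilon>"] eps_pos by (simp add: mult_ac)
    finally show "real_of_int N * \<pi> x \<le> 1 + \<epsilon>" by simp
  }
qed

text \<open>The variance of a three-point law is the sum of squared differences over pairs, weighted
  by products of probabilities. Only the pair \<open>g x\<close>, \<open>g (csuc N x)\<close> is
  kept, with \<open>up x\<close> bounded below by the light weight.\<close>

lemma twisted_variance:
  assumes "x \<in> V"
  shows "(\<Sum>y\<in>V. K x y * f y)\<^sup>2
    \<le> (\<Sum>y\<in>V. K x y * (f y)\<^sup>2) - 1 / (4 * (2 + \<epsilon>)) * (f (g (csuc N x)) - f (g x))\<^sup>2"
proof -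
  let ?\<alpha> = "f (g x)" and ?\<beta> = "f (g (csuc N x))" and ?\<gamma> = "f (g (cpred N x))"
  let ?u = "up x" and ?d = "down x"
  have d: "?d = 1 / 2 - ?u" using up_add_down[of x] by simp
  have "(?\<alpha>\<^sup>2 / 2 + ?u * ?\<beta>\<^sup>2 + ?d * ?\<gamma>\<^sup>2) - (?\<alpha> / 2 + ?u * ?\<beta> + ?d * ?\<gamma>)\<^sup>2
      = ?u * (?\<beta> - ?\<alpha>)\<^sup>2 / 2 + ?d * (?\<alpha> - ?\<gamma>)\<^sup>2 / 2 + ?u * ?d * (?\<beta> - ?\<gamma>)\<^sup>2"
    unfolding d by (simp add: power2_eq_square field_simps)
  also have "\<dots> \<ge> ?u * (?\<beta> - ?\<alpha>)\<^sup>2 / 2"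
    using up_pos[of x] down_pos[of x] by simp
  finally have "?u * (?\<beta> - ?\<alpha>)\<^sup>2 / 2
    \<le> (?\<alpha>\<^sup>2 / 2 + ?u * ?\<beta>\<^sup>2 + ?d * ?\<gamma>\<^sup>2) - (?\<alpha> / 2 + ?u * ?\<beta> + ?d * ?\<gamma>)\<^sup>2" .
  moreover have "1 / (4 * (2 + \<epsilon>)) * (?\<beta> - ?\<alpha>)\<^sup>2 \<le> ?u * (?\<beta> - ?\<alpha>)\<^sup>2 / 2"
  proof -
    have "1 / (4 * (2 + \<epsilon>)) = 1 / (2 * (2 + \<epsilon>)) / 2" by simp
    also have "\<dots> \<le> ?u / 2" using up_ge[of x] by (rule divide_right_mono) simp
    finally have "1 / (4 * (2 + \<epsilon>)) * (?\<beta> - ?\<alpha>)\<^sup>2 \<le> ?u / 2 * (?\<beta> - ?\<alpha>)\<^sup>2"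
      by (rule mult_right_mono) simp
    then show ?thesis by simp
  qed
  ultimately have "1 / (4 * (2 + \<epsilon>)) * (?\<beta> - ?\<alpha>)\<^sup>2
    \<le> (?\<alpha>\<^sup>2 / 2 + ?u * ?\<beta>\<^sup>2 + ?d * ?\<gamma>\<^sup>2) - (?\<alpha> / 2 + ?u * ?\<beta> + ?d * ?\<gamma>)\<^sup>2"
    by (rule order_trans[rotated])
  then show ?thesis
    unfolding twisted_apply[OF assms] le_diff_eq by (simp only: add.commute)
qed

text \<open>On integrating \<open>twisted_variance\<close> against \<open>\<pi>\<close>, invariance
  turns the averaged squares back into the energy of \<open>f\<close>.\<close>

lemma energy_drop:
  "(\<Sum>x\<in>V. \<pi> x * (\<Sum>y\<in>V. K x y * f y)\<^sup>2)
    \<le> (\<Sum>x\<in>V. \<pi> x * (f x)\<^sup>2)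
      - 1 / (4 * (2 + \<epsilon>)) * (\<Sum>x\<in>V. \<pi> x * (f (g (csuc N x)) - f (g x))\<^sup>2)"
proof -
  have "(\<Sum>x\<in>V. \<pi> x * (\<Sum>y\<in>V. K x y * f y)\<^sup>2) \<le> (\<Sum>x\<in>V. \<pi> x * ((\<Sum>y\<in>V. K x y * (f y)\<^sup>2)
      - 1 / (4 * (2 + \<epsilon>)) * (f (g (csuc N x)) - f (g x))\<^sup>2))"
    using invariant_pos[OF invariant]
    by (intro sum_mono mult_left_mono twisted_variance) (auto simp: less_imp_le)
  also have "\<dots> = (\<Sum>x\<in>V. \<Sum>y\<in>V. \<pi> x * K x y * (f y)\<^sup>2)
      - 1 / (4 * (2 + \<epsilon>)) * (\<Sum>x\<in>V. \<pi> x * (f (g (csuc N x)) - f (g x))\<^sup>2)"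
    by (simp add: right_diff_distrib sum_subtractf sum_distrib_left mult_ac)
  also have "(\<Sum>x\<in>V. \<Sum>y\<in>V. \<pi> x * K x y * (f y)\<^sup>2) = (\<Sum>y\<in>V. \<Sum>x\<in>V. \<pi> x * K x y * (f y)\<^sup>2)"
    by (rule sum.swap)
  also have "\<dots> = (\<Sum>y\<in>V. \<pi> y * (f y)\<^sup>2)"
    using invariant by (intro sum.cong) (auto simp: invariant_prob_def simp flip: sum_distrib_right)
  finally show ?thesis .
qed

text \<open>The first \<open>Q\<close> steps use the Nash inequality, the next \<open>k * Q\<close>
  the Poincare inequality, and the last \<open>Q\<close> convert energy into a supremum
  bound.\<close>

lemma kernel_power_relative_error:
  assumes x: "x \<in> V" and z: "z \<in> V" and Q: "Q = nat N ^ 2"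
  shows "((kernel_power V K ((k + 2) * Q) x z - \<pi> z) / \<pi> z) ^ 4
    \<le> merging_const \<epsilon> * exp (- 2 * spectral_rate \<epsilon> * real k)"
proof -
  define R where "R = 1 + \<epsilon>"
  have R: "1 < R" using eps_pos by (simp add: R_def)
  define c where "c = dissipation \<epsilon>"
  define \<kappa> where "\<kappa> = nash_rate \<epsilon>"
  define q where "q = spectral_rate \<epsilon>"
  have pos: "0 < c" "0 < \<kappa>" "0 < q" using rates_pos[OF eps_pos] by (auto simp: c_def \<kappa>_def q_def)
  define n\<^sub>R where "n\<^sub>R = real_of_int N"
  have nR: "0 < n\<^sub>R" using N_pos by (simp add: n\<^sub>R_def)
  have QR: "real Q = n\<^sub>R\<^sup>2" using N_ge_3 by (simp add: Q n\<^sub>R_def)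
  have Q0: "0 < Q" using N_ge_3 by (simp add: Q)
  note \<pi>0 = invariant_pos[OF invariant]
  have lower: "1 \<le> R * (n\<^sub>R * \<pi> x)" and upper: "n\<^sub>R * \<pi> x \<le> R" if "x \<in> V" for x
    using pi_lower[OF that] pi_upper[OF that] by (auto simp: R_def n\<^sub>R_def)
  have stoch: "stochastic V (kernel_power V K n)" for n
    by (rule stochastic_kernel_power[OF finite_vertices stochastic_K])
  define a where "a n x = kernel_power V K n x z - \<pi> z" for n x
  have rec: "a (Suc n) x = (\<Sum>y\<in>V. K x y * a n y)" if "x \<in> V" for n x
    using stochastic_sum[OF stochastic_K that]
    unfolding a_def kernel_power_Suc_left[OF finite_vertices that z]
    by (simp add: right_diff_distrib sum_subtractf flip: sum_distrib_right)
  have push: "(\<Sum>x\<in>V. \<pi> x * kernel_power V K n x z) = \<pi> z" for n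
    using invariant z by (intro invariant_kernel_power) (auto simp: invariant_prob_def)
  have mean: "(\<Sum>x\<in>V. \<pi> x * a n x) = 0" for n
    using push pi_sum by (simp add: a_def right_diff_distrib sum_subtractf flip: sum_distrib_right)
  \<comment> \<open>\<open>D\<close> is the circle Dirichlet form of \<open>a n\<close> composed
    with \<open>g\<close>, the function to which the circle inequalities are applied. The factor
    \<open>N\<close> in \<open>w\<close> makes it comparable with \<open>S\<close> up to
    \<open>R\<close>.\<close>
  define S where "S n = (\<Sum>x\<in>V. (a n x)\<^sup>2)" for n
  define D where "D n = (\<Sum>x\<in>V. (a n (g (csuc N x)) - a n (g x))\<^sup>2)" for n
  define w where "w n = (\<Sum>x\<in>V. n\<^sub>R * \<pi> x * (a n x)\<^sup>2)" for n
  have D0: "0 \<le> D n" for n by (simp add: D_def sum_nonneg)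
  have S0: "0 \<le> S n" for n by (simp add: S_def sum_nonneg)
  have w0: "0 \<le> w n" for n
    using nR \<pi>0 by (auto simp: w_def less_imp_le intro!: sum_nonneg mult_nonneg_nonneg)
  have wS: "w n \<le> R * S n" for n
    unfolding w_def S_def sum_distrib_left using upper by (intro sum_mono mult_right_mono) auto
  have Sw: "S n \<le> R * w n" for n
  proof -
    have "(a n x)\<^sup>2 \<le> R * (n\<^sub>R * \<pi> x * (a n x)\<^sup>2)" if "x \<in> V" for x
      using mult_right_mono[OF lower[OF that], of "(a n x)\<^sup>2"] by (simp add: mult_ac)
    then show ?thesis unfolding w_def S_def sum_distrib_left by (intro sum_mono)
  qed
  \<comment> \<open>Invariance fixes the \<open>\<pi>\<close>-weighted total of the column at
    \<open>\<pi> z\<close>, so this bound depends neither on \<open>n\<close> nor on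
    \<open>N\<close>.\<close>
  have L1: "(\<Sum>x\<in>V. \<bar>a n x\<bar>) \<le> 2 * R\<^sup>2" for n
  proof -
    have "\<bar>a n x\<bar> \<le> R * n\<^sub>R * (\<pi> x * (kernel_power V K n x z + \<pi> z))" if "x \<in> V" for x
    proof -
      have "\<bar>a n x\<bar> \<le> kernel_power V K n x z + \<pi> z"
        using stochastic_nonneg[OF stoch that z, of n] \<pi>0[OF z] by (auto simp: a_def)
      also have "\<dots> \<le> R * (n\<^sub>R * \<pi> x) * (kernel_power V K n x z + \<pi> z)"
        using mult_right_mono[OF lower[OF that], of "kernel_power V K n x z + \<pi> z"]
          stochastic_nonneg[OF stoch that z, of n] \<pi>0[OF z] by simp
      finally show ?thesis by (simp add: mult_ac)
    qed
    then have "(\<Sum>x\<in>V. \<bar>a n x\<bar>) \<le> R * n\<^sub>R * (\<Sum>x\<in>V. \<pi> x * (kernel_power V K n x z + \<pi> z))"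
      unfolding sum_distrib_left by (intro sum_mono)
    also have "(\<Sum>x\<in>V. \<pi> x * (kernel_power V K n x z + \<pi> z)) = 2 * \<pi> z"
      using push pi_sum by (simp add: distrib_left sum.distrib flip: sum_distrib_right)
    also have "R * n\<^sub>R * (2 * \<pi> z) = 2 * R * (n\<^sub>R * \<pi> z)" by simp
    also have "\<dots> \<le> 2 * R * R" using upper[OF z] R by (intro mult_left_mono) auto
    finally show ?thesis by (simp add: power2_eq_square)
  qed
  have reindex: "(\<Sum>x\<in>V. f (g x)) = (\<Sum>x\<in>V. f x)" for f :: "int \<Rightarrow> real"
    by (rule sum.reindex_bij_betw[OF bij_g])
  have mean_g: "(\<Sum>x\<in>V. \<pi> (g x) * a n (g x)) = 0" for n
    using mean reindex[of "\<lambda>x. \<pi> x * a n x"] by simp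
  have \<pi>g: "0 < \<pi> (g x)" if "x \<in> V" for x using \<pi>0 g_in that by blast
  have S_g: "(\<Sum>x\<in>V. (a n (g x))\<^sup>2) = S n" for n
    unfolding S_def by (rule reindex)
  have drop: "w (Suc n) \<le> w n - c * D n" for n
  proof -
    have "w (Suc n) = n\<^sub>R * (\<Sum>x\<in>V. \<pi> x * (\<Sum>y\<in>V. K x y * a n y)\<^sup>2)"
      by (simp add: w_def rec sum_distrib_left mult_ac)
    also have "\<dots> \<le> n\<^sub>R * ((\<Sum>x\<in>V. \<pi> x * (a n x)\<^sup>2)
      - 1 / (4 * (2 + \<epsilon>)) * (\<Sum>x\<in>V. \<pi> x * (a n (g (csuc N x)) - a n (g x))\<^sup>2))"
      using nR energy_drop by (intro mult_left_mono) auto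
    also have "\<dots> = w n - 1 / (4 * (2 + \<epsilon>)) *
        (\<Sum>x\<in>V. n\<^sub>R * \<pi> x * (a n (g (csuc N x)) - a n (g x))\<^sup>2)"
      by (simp add: w_def right_diff_distrib sum_distrib_left mult_ac)
    also have "\<dots> \<le> w n - 1 / (4 * (2 + \<epsilon>)) * (D n / R)"
    proof (intro diff_left_mono mult_left_mono)
      have "1 / R \<le> n\<^sub>R * \<pi> x" if "x \<in> V" for x
        using lower[OF that] R by (simp add: field_simps)
      then have "1 / R * (a n (g (csuc N x)) - a n (g x))\<^sup>2
          \<le> n\<^sub>R * \<pi> x * (a n (g (csuc N x)) - a n (g x))\<^sup>2" if "x \<in> V" for x
        using that by (intro mult_right_mono) auto
      then have "1 / R * D n \<le> (\<Sum>x\<in>V. n\<^sub>R * \<pi> x * (a n (g (csuc N x)) - a n (g x))\<^sup>2)"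
        unfolding D_def sum_distrib_left by (intro sum_mono)
      then show "D n / R \<le> (\<Sum>x\<in>V. n\<^sub>R * \<pi> x * (a n (g (csuc N x)) - a n (g x))\<^sup>2)" by simp
    qed (use eps_pos in auto)
    also have "1 / (4 * (2 + \<epsilon>)) * (D n / R) = c * D n"
      by (simp add: c_def dissipation_def R_def)
    finally show ?thesis .
  qed
  have wdec: "w (Suc n) \<le> w n" for n
    using drop[of n] mult_nonneg_nonneg[OF less_imp_le[OF pos(1)] D0[of n]] by linarith
  have "(w n) ^ 3 \<le> R ^ 3 * (4 * (2 * R\<^sup>2) ^ 4) * D n" for n
  proof -
    have "(w n) ^ 3 \<le> (R * S n) ^ 3" using wS w0 by (intro power_mono)
    also have "\<dots> = R ^ 3 * (S n) ^ 3" by (simp add: power_mult_distrib)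
    also have "\<dots> \<le> R ^ 3 * (4 * D n * (\<Sum>x\<in>V. \<bar>a n (g x)\<bar>) ^ 4)"
      using circle_Nash[OF \<pi>g mean_g] R by (intro mult_left_mono) (auto simp: D_def S_g)
    also have "\<dots> \<le> R ^ 3 * (4 * D n * (2 * R\<^sup>2) ^ 4)"
      using L1 R D0
      by (intro mult_left_mono power_mono) (auto simp: reindex[of "\<lambda>x. \<bar>a n x\<bar>"] sum_nonneg)
    finally show ?thesis by (simp add: mult_ac)
  qed
  then have "\<kappa> * (w n) ^ 3 \<le> \<kappa> * (R ^ 3 * (4 * (2 * R\<^sup>2) ^ 4) * D n)" for n
    using pos by (intro mult_left_mono) auto
  moreover have "\<kappa> * (R ^ 3 * (4 * (2 * R\<^sup>2) ^ 4) * D n) = c * D n" for n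
    using R by (simp add: \<kappa>_def nash_rate_def c_def R_def[symmetric])
  ultimately have cubic: "w (Suc n) \<le> w n - \<kappa> * (w n) ^ 3" for n
    using drop[of n] by (metis diff_left_mono order_trans)
  have "2 * \<kappa> * real Q * (w Q)\<^sup>2 \<le> 1"
    by (rule cubic_recursion_decay[where w = w, OF w0 pos(2) cubic])
  then have wQ: "(w Q)\<^sup>2 \<le> 1 / (2 * \<kappa> * n\<^sub>R\<^sup>2)"
    using pos nR by (simp add: QR field_simps)
  have "w (Suc n) \<le> (1 - q / real Q) * w n" for n
  proof -
    have "w n \<le> R * S n" by (rule wS)
    also have "\<dots> \<le> R * (4 * n\<^sub>R\<^sup>2 * D n)"
      using circle_Poincare[OF \<pi>g mean_g] N_ge_3 R
      by (intro mult_left_mono) (auto simp: D_def S_g n\<^sub>R_def)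
    finally have "w n \<le> R * (4 * n\<^sub>R\<^sup>2 * D n)" .
    then have "q / real Q * w n \<le> q / real Q * (R * (4 * n\<^sub>R\<^sup>2 * D n))"
      using pos by (intro mult_left_mono) auto
    also have "\<dots> = c * D n"
      using nR R by (simp add: QR q_def spectral_rate_def c_def R_def[symmetric])
    finally show ?thesis using drop[of n] by (simp add: algebra_simps)
  qed
  from geometric_recursion_decay[where w = w, OF w0 this, of Q "k * Q"]
  have wk: "w ((k + 1) * Q) \<le> exp (- q * real k) * w Q"
    using Q0 by (simp add: algebra_simps)
  define m where "m = (k + 1) * Q"
  obtain j where j: "j < Q" "real Q * (c * D (m + j)) \<le> w m"
    using telescoping_pigeonhole[where w = w and D = D, OF w0 drop Q0] by blast
  have "(a (m + j) x) ^ 4 \<le> merging_const \<epsilon> * exp (- 2 * q * real k) / (R * n\<^sub>R) ^ 4" (is "_ \<le> ?B")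
    if "x \<in> V" for x
  proof -
    have "x \<in> g ` V" using that permutes_image[OF g_permutes] by simp
    then obtain u where u: "u \<in> V" "x = g u" by auto
    have "(a (m + j) x) ^ 4 \<le> 4 * D (m + j) * S (m + j)"
      using circle_sup_bound[OF \<pi>g mean_g u(1)] u(2) by (simp add: D_def S_g)
    also have "\<dots> \<le> 4 * (w m / (c * n\<^sub>R\<^sup>2)) * (R * w m)"
    proof (intro mult_mono mult_left_mono)
      show "D (m + j) \<le> w m / (c * n\<^sub>R\<^sup>2)" using j(2) pos nR by (simp add: QR field_simps)
      have "w (m + j) \<le> w m" by (rule lift_Suc_antimono_le[of w, OF wdec]) simp
      then have "R * w (m + j) \<le> R * w m" using R by (intro mult_left_mono) auto
      with Sw[of "m + j"] show "S (m + j) \<le> R * w m" by (rule order_trans)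
    qed (use w0 S0 D0 pos in auto)
    also have "\<dots> = 4 * R / (c * n\<^sub>R\<^sup>2) * (w m)\<^sup>2" by (simp add: power2_eq_square)
    also have "\<dots> \<le> 4 * R / (c * n\<^sub>R\<^sup>2) * (exp (- q * real k) * w Q)\<^sup>2"
      using wk w0 R pos by (intro mult_left_mono power_mono) (auto simp: m_def)
    also have "\<dots> = 4 * R / (c * n\<^sub>R\<^sup>2) * (exp (- 2 * q * real k) * (w Q)\<^sup>2)"
      by (simp add: power_mult_distrib flip: exp_of_nat_mult)
    also have "\<dots> \<le> 4 * R / (c * n\<^sub>R\<^sup>2) * (exp (- 2 * q * real k) * (1 / (2 * \<kappa> * n\<^sub>R\<^sup>2)))"
      using R pos wQ by (intro mult_left_mono) auto
    also have "\<dots> = ?B"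
    proof -
      have *: "4 * R / (c * n\<^sub>R\<^sup>2) * (E * (1 / (2 * \<kappa> * n\<^sub>R\<^sup>2)))
          = 2 * R ^ 5 / (c * \<kappa>) * E / (R * n\<^sub>R) ^ 4" for E
        using R pos nR by (simp add: power_mult_distrib divide_simps) (simp add: eval_nat_numeral)
      have "merging_const \<epsilon> = 2 * R ^ 5 / (c * \<kappa>)"
        by (simp add: merging_const_def c_def \<kappa>_def R_def)
      then show ?thesis by (simp only: *)
    qed
    finally show ?thesis .
  qed
  then have bound: "\<forall>x\<in>V. (a (m + j) x) ^ 4 \<le> ?B" by blast
  \<comment> \<open>The good time \<open>m + j\<close> depends on \<open>z\<close>; as suprema do
    not grow, the bound carries over to the common time \<open>(k + 2) * Q\<close>.\<close>
  have "\<forall>x\<in>V. (a (m + j + i) x) ^ 4 \<le> ?B" for i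
  proof (induction i)
    case 0
    show ?case using bound by simp
  next
    case (Suc i)
    define X where "X = Max ((\<lambda>x. \<bar>a (m + j + i) x\<bar>) ` V)"
    have "X \<in> (\<lambda>x. \<bar>a (m + j + i) x\<bar>) ` V" unfolding X_def using V_ne by (intro Max_in) auto
    then have X: "X ^ 4 \<le> ?B" using Suc by auto
    have leX: "\<bar>a (m + j + i) x\<bar> \<le> X" if "x \<in> V" for x
      unfolding X_def using that by (intro Max_ge) auto
    show ?case
    proof
      fix x assume x: "x \<in> V"
      have "a (m + j + Suc i) x = (\<Sum>y\<in>V. K x y * a (m + j + i) y)" using rec[OF x] by simp
      then have "\<bar>a (m + j + Suc i) x\<bar> \<le> X"
        using stochastic_average_le[OF stochastic_K x, of "a (m + j + i)" X]
          stochastic_average_ge[OF stochastic_K x, of "- X" "a (m + j + i)"] leX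
        by (auto simp: abs_le_iff minus_le_iff)
      then have "\<bar>a (m + j + Suc i) x\<bar> ^ 4 \<le> X ^ 4" by (intro power_mono) auto
      with X show "(a (m + j + Suc i) x) ^ 4 \<le> ?B" by simp
    qed
  qed
  from this[of "Q - j"] have final: "(a ((k + 2) * Q) x) ^ 4 \<le> ?B"
    using j(1) x by (simp add: m_def algebra_simps)
  have "((a ((k + 2) * Q) x) / \<pi> z) ^ 4 = (a ((k + 2) * Q) x) ^ 4 / (\<pi> z) ^ 4"
    by (rule power_divide)
  also have "\<dots> \<le> (a ((k + 2) * Q) x) ^ 4 * (R * n\<^sub>R) ^ 4"
  proof -
    have "1 / \<pi> z \<le> R * n\<^sub>R" using lower[OF z] \<pi>0[OF z] by (simp add: field_simps)
    then have "(1 / \<pi> z) ^ 4 \<le> (R * n\<^sub>R) ^ 4" using \<pi>0[OF z] by (intro power_mono) auto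
    then have "(a ((k + 2) * Q) x) ^ 4 * (1 / \<pi> z) ^ 4 \<le> (a ((k + 2) * Q) x) ^ 4 * (R * n\<^sub>R) ^ 4"
      by (intro mult_left_mono) auto
    then show ?thesis by (simp add: power_divide)
  qed
  also have "\<dots> \<le> ?B * (R * n\<^sub>R) ^ 4" using final by (intro mult_right_mono) auto
  also have "\<dots> = merging_const \<epsilon> * exp (- 2 * q * real k)" using R nR by simp
  finally show ?thesis by (simp add: a_def q_def)
qed

end

section \<open>Return to the inhomogeneous product and its merging time\<close>

context circle_chain
begin

text \<open>Substituting \<open>u = (g ^^ n) y\<close> turns factor \<open>n + 1\<close> into the
  circle kernel from \<open>u\<close> to \<open>(g ^^ n) z\<close>, which is \<open>K\<close> from
  \<open>u\<close> to \<open>(g ^^ Suc n) z\<close>.\<close>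

lemma shifted_iter_kernel:
  assumes "x \<in> V" "z \<in> V"
  shows "iter_kernel V (shifted_kernels (circle_kernel \<epsilon> N) g) n x z
    = kernel_power V K n x ((g ^^ n) z)"
  using assms(2)
proof (induction n arbitrary: z)
  case (Suc n)
  have bij: "bij_betw (g ^^ n) V V" using bij_g by (rule bij_betw_funpow)
  have "iter_kernel V (shifted_kernels (circle_kernel \<epsilon> N) g) (Suc n) x z
      = (\<Sum>y\<in>V. kernel_power V K n x ((g ^^ n) y) * circle_kernel \<epsilon> N ((g ^^ n) y) ((g ^^ n) z))"
    by (simp add: kernel_comp_def shifted_kernels_def Suc.IH)
  also have "\<dots> = (\<Sum>u\<in>V. kernel_power V K n x u * circle_kernel \<epsilon> N u ((g ^^ n) z))"
    by (rule sum.reindex_bij_betw[OF bij])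
  also have "\<dots> = kernel_power V K (Suc n) x ((g ^^ Suc n) z)"
    by (simp add: kernel_comp_def twisted_kernel_def permutes_inverses[OF g_permutes])
  finally show ?case .
qed simp

text \<open>Both entries of a ratio have the same relabelled target, so its deviation from 1 is
  \<open>(\<delta>x - \<delta>y) / (1 + \<delta>y)\<close>. The margin 8 keeps the denominator above
  \<open>1 / 2\<close> and the numerator at most \<open>\<eta> / 4\<close>.\<close>

lemma rel_sup_dev_less:
  assumes \<eta>: "0 < \<eta>"
    and dev: "\<And>x z. x \<in> V \<Longrightarrow> z \<in> V \<Longrightarrow> \<bar>(kernel_power V K n x z - \<pi> z) / \<pi> z\<bar> \<le> min 1 \<eta> / 8"
    and \<pi>: "\<And>z. z \<in> V \<Longrightarrow> 0 < \<pi> z"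
  shows "rel_sup_dev V (iter_kernel V (shifted_kernels (circle_kernel \<epsilon> N) g) n) < ereal \<eta>"
proof -
  let ?I = "iter_kernel V (shifted_kernels (circle_kernel \<epsilon> N) g) n"
  have gn: "(g ^^ n) z \<in> V" if "z \<in> V" for z
    using bij_betw_funpow[OF bij_g, of n] that by (auto simp: bij_betw_def)
  have close: "?I y z \<noteq> 0 \<and> \<bar>?I x z / ?I y z - 1\<bar> < \<eta>" if xyz: "x \<in> V" "y \<in> V" "z \<in> V" for x y z
  proof -
    define p where "p = \<pi> ((g ^^ n) z)"
    define \<delta>x where "\<delta>x = (?I x z - p) / p"
    define \<delta>y where "\<delta>y = (?I y z - p) / p"
    have p: "0 < p" using \<pi> gn xyz by (simp add: p_def)
    have I: "?I x z = p * (1 + \<delta>x)" "?I y z = p * (1 + \<delta>y)"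
      using p by (auto simp: \<delta>x_def \<delta>y_def field_simps)
    have d: "\<bar>\<delta>x\<bar> \<le> min 1 \<eta> / 8" "\<bar>\<delta>y\<bar> \<le> min 1 \<eta> / 8"
      using dev[OF xyz(1) gn[OF xyz(3)]] dev[OF xyz(2) gn[OF xyz(3)]] xyz
      by (simp_all add: \<delta>x_def \<delta>y_def p_def shifted_iter_kernel)
    have y: "1 / 2 < 1 + \<delta>y" using d by linarith
    have "?I x z / ?I y z - 1 = (\<delta>x - \<delta>y) / (1 + \<delta>y)"
    proof -
      have "1 + \<delta>y \<noteq> 0" using y by simp
      then show ?thesis using p unfolding I by (simp add: divide_simps)
    qed
    also have "\<bar>\<dots>\<bar> = \<bar>\<delta>x - \<delta>y\<bar> / (1 + \<delta>y)" using y by (simp add: abs_divide)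
    also have "\<dots> < \<eta>"
    proof -
      have "\<bar>\<delta>x - \<delta>y\<bar> \<le> \<eta> / 4" using d by linarith
      also have "\<dots> < \<eta> * (1 / 2)" using \<eta> by simp
      also have "\<dots> \<le> \<eta> * (1 + \<delta>y)" using y \<eta> by (intro mult_left_mono) auto
      finally show ?thesis using y by (simp add: divide_less_eq)
    qed
    finally show ?thesis using p y unfolding I by auto
  qed
  let ?A = "{\<bar>?I x z / ?I y z - 1\<bar> | x y z. x \<in> V \<and> y \<in> V \<and> z \<in> V}"
  have "?A = (\<lambda>(x, y, z). \<bar>?I x z / ?I y z - 1\<bar>) ` (V \<times> V \<times> V)"
    by (auto simp: image_iff) blast
  then have "finite ?A" by simp
  moreover have "?A \<noteq> {}" using V_ne by blast
  ultimately have "Max ?A < \<eta>" using close by auto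
  moreover have "\<not> (\<exists>y\<in>V. \<exists>z\<in>V. ?I y z = 0)" using close by blast
  ultimately show ?thesis by (simp add: rel_sup_dev_def)
qed

text \<open>Enough windows are taken to push the fourth power of the relative error below
  \<open>(min 1 \<eta> / 8) ^ 4\<close>, whence \<open>4096 = 8 ^ 4\<close>. The absolute value of
  the logarithm keeps the number of windows nonnegative.\<close>

lemma merging_time_bound:
  assumes \<eta>: "0 < \<eta>"
  defines "C \<equiv> 3 + (\<bar>ln (4096 * merging_const \<epsilon>)\<bar> + 4) / (2 * spectral_rate \<epsilon>)"
  shows "ereal_of_enat (rel_sup_merging_time V (shifted_kernels (circle_kernel \<epsilon> N) g) \<eta>)
    \<le> ereal (C * (real_of_int N)\<^sup>2 * (1 + log_plus (1 / \<eta>)))"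
proof -
  obtain \<pi> where \<pi>: "invariant_prob V K \<pi>" using invariant_unique by blast
  interpret circle_chain_invariant \<epsilon> N g \<pi> by unfold_locales (rule \<pi>)
  define q where "q = spectral_rate \<epsilon>"
  define \<Theta> where "\<Theta> = merging_const \<epsilon>"
  have q: "0 < q" and \<Theta>: "0 < \<Theta>" using rates_pos[OF eps_pos] by (auto simp: q_def \<Theta>_def)
  define L where "L = log_plus (1 / \<eta>)"
  have L: "0 \<le> L" by (simp add: L_def log_plus_def)
  define T where "T = (\<bar>ln (4096 * \<Theta>)\<bar> + 4 * L) / (2 * q)"
  have T: "0 \<le> T" using q L by (simp add: T_def)
  define k where "k = nat \<lceil>T\<rceil>"
  have kT: "T \<le> real k" "real k \<le> T + 1" using T by (auto simp: k_def)
  define Q where "Q = nat N ^ 2"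
  define n where "n = (k + 2) * Q"
  \<comment> \<open>This identity is where \<open>log_plus\<close> enters: the threshold is capped
    at 1 exactly as the logarithm is cut off at 0.\<close>
  have expL: "exp (- L) = min 1 \<eta>"
    using \<eta> by (auto simp: L_def log_plus_def ln_div max_def min_def exp_minus)
  have "\<bar>ln (4096 * \<Theta>)\<bar> + 4 * L \<le> 2 * q * real k"
    using kT(1) q by (simp add: T_def field_simps)
  then have "ln (4096 * \<Theta>) - 2 * q * real k \<le> - 4 * L" by linarith
  then have "exp (ln (4096 * \<Theta>) - 2 * q * real k) \<le> exp (- 4 * L)" by simp
  also have "exp (- 4 * L) = exp (- L) ^ 4" by (simp flip: exp_of_nat_mult)
  finally have "4096 * (\<Theta> * exp (- 2 * q * real k)) \<le> (min 1 \<eta>) ^ 4"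
    using \<Theta> unfolding expL by (simp add: exp_diff exp_minus divide_inverse mult_ac)
  then have small: "\<Theta> * exp (- 2 * q * real k) \<le> (min 1 \<eta> / 8) ^ 4"
    by (simp add: power_divide)
  have "\<bar>(kernel_power V K n x z - \<pi> z) / \<pi> z\<bar> \<le> min 1 \<eta> / 8" if "x \<in> V" "z \<in> V" for x z
  proof (rule power_le_imp_le_base)
    have "\<bar>(kernel_power V K n x z - \<pi> z) / \<pi> z\<bar> ^ Suc 3 = ((kernel_power V K n x z - \<pi> z) / \<pi> z) ^ 4"
      by (simp del: abs_divide)
    also have "\<dots> \<le> (min 1 \<eta> / 8) ^ 4"
      using kernel_power_relative_error[OF that Q_def, of k] small by (simp add: n_def q_def \<Theta>_def)
    finally show "\<bar>(kernel_power V K n x z - \<pi> z) / \<pi> z\<bar> ^ Suc 3 \<le> (min 1 \<eta> / 8) ^ Suc 3" by simp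
  qed (use \<eta> in auto)
  from rel_sup_dev_less[OF \<eta> this invariant_pos[OF \<pi>]]
  have "rel_sup_merging_time V (shifted_kernels (circle_kernel \<epsilon> N) g) \<eta> \<le> enat n"
    unfolding rel_sup_merging_time_def by (intro Inf_lower) auto
  then have "ereal_of_enat (rel_sup_merging_time V (shifted_kernels (circle_kernel \<epsilon> N) g) \<eta>)
      \<le> ereal_of_enat (enat n)"
    by (simp only: ereal_of_enat_le_iff)
  also have "\<dots> = ereal (real n)" by simp
  \<comment> \<open>The 3 in \<open>C\<close> accounts for the two extra windows and for rounding
    \<open>T\<close> up to \<open>k\<close>.\<close>
  also have "real n \<le> C * (real_of_int N)\<^sup>2 * (1 + L)"
  proof -
    let ?l = "\<bar>ln (4096 * \<Theta>)\<bar>"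
    have "T = ?l / (2 * q) + 4 / (2 * q) * L" by (simp add: T_def add_divide_distrib)
    moreover have "0 \<le> ?l / (2 * q)" "0 \<le> 4 / (2 * q)" using q by auto
    ultimately have "T \<le> (?l / (2 * q) + 4 / (2 * q)) * (1 + L)"
      using L by (simp add: distrib_left distrib_right)
    moreover have "C = 3 + (?l / (2 * q) + 4 / (2 * q))"
      by (simp add: C_def \<Theta>_def q_def add_divide_distrib)
    ultimately have "real k + 2 \<le> C * (1 + L)" using kT(2) L by (simp add: distrib_right)
    moreover have "real n = (real k + 2) * (real_of_int N)\<^sup>2"
      using N_ge_3 by (simp add: n_def Q_def distrib_right)
    ultimately show ?thesis
      using mult_right_mono[of "real k + 2" "C * (1 + L)" "(real_of_int N)\<^sup>2"] by (simp add: mult_ac)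
  qed
  finally show ?thesis by (simp add: L_def)
qed

end

text \<open>Existence and uniqueness belong to the conclusion because they justify speaking of the
  invariant measure.\<close>

theorem theorem5p3:
  fixes \<epsilon> :: real
  assumes "\<epsilon> > 0"
  shows "\<exists>C::real. \<forall>(N::int) (g::int \<Rightarrow> int).
    odd N \<and> N \<ge> 3 \<and> g permutes vertices N \<longrightarrow>
      (\<exists>!\<pi>. invariant_prob (vertices N) (twisted_kernel (circle_kernel \<epsilon> N) g) \<pi>) \<and>
      (\<forall>\<pi>. invariant_prob (vertices N) (twisted_kernel (circle_kernel \<epsilon> N) g) \<pi> \<longrightarrow>
         Max (\<pi> ` vertices N) \<le> (1 + \<epsilon>) * Min (\<pi> ` vertices N)) \<and>
      (\<forall>\<eta>::real. \<eta> > 0 \<longrightarrow>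
         ereal_of_enat
           (rel_sup_merging_time (vertices N) (shifted_kernels (circle_kernel \<epsilon> N) g) \<eta>)
         \<le> ereal (C * (real_of_int N)\<^sup>2 * (1 + log_plus (1 / \<eta>))))"
proof (intro exI allI impI)
  fix N g assume "odd N \<and> N \<ge> 3 \<and> g permutes vertices N"
  then interpret circle_chain \<epsilon> N g using assms by unfold_locales auto
  show "(\<exists>!\<pi>. invariant_prob V K \<pi>) \<and>
      (\<forall>\<pi>. invariant_prob V K \<pi> \<longrightarrow> Max (\<pi> ` V) \<le> (1 + \<epsilon>) * Min (\<pi> ` V)) \<and>
      (\<forall>\<eta>::real. \<eta> > 0 \<longrightarrow>
         ereal_of_enat (rel_sup_merging_time V (shifted_kernels (circle_kernel \<epsilon> N) g) \<eta>)
         \<le> ereal ((3 + (\<bar>ln (4096 * merging_const \<epsilon>)\<bar> + 4) / (2 * spectral_rate \<epsilon>))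
             * (real_of_int N)\<^sup>2 * (1 + log_plus (1 / \<eta>))))"
    using invariant_unique invariant_max_le_min merging_time_bound by blast
qed

end
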